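(* Let $\mathcal W$ be a connected Weyl graph of type $M$. Let $\mathcal S$ be a generating set of $\mathcal W$ and let $T$ be a spanning tree of $\mathcal W$. Then the local groups of the fundamental groupoid $\overline{\mathcal W}$ are naturally isomorphic to $\pi_1(\mathcal W,T)$ (naturally, given the choice of $T$).
   Context: Setting. $M=(m_{st})_{s,t\in S}$ is a Coxeter matrix on a finite set $S$, and $W=\langle S\mid (st)^{m_{st}}=1,\ m_{st}<\infty\rangle$ is its Coxeter group. A word over $S$ is reduced if no shorter word represents the same element of $W$. For $s\ne t$ let $p_m(s,t)=stst\cdots$ ($m$ letters), and if $m_{st}<\infty$ let $p(s,t)=p_{m_{st}}(s,t)$. Groupoids are small and non-empty, with composition $g;h$ (or $gh$) written left to right, defined when $\tau(g)=\iota(h)$, where $\iota,\tau$ denote initial and terminal vertices; the local group of a groupoid at a vertex $x$ is the group of edges from $x$ to $x$. Weyl data. A generalized chamber system $\mathcal W$ of type $M$ is a set $\mathcal W_0$ of chambers with a family of groupoids $(\mathcal W_s)_{s\in S}$ (panel groupoids), each with vertex set $\mathcal W_0$. An edge of $\mathcal W$ of type $s$ is a non-identity edge of $\mathcal W_s$ (edges of different types are distinct). An $s$-panel is a connected component of $\mathcal W_s$. A gallery $\beta$ is a finite sequence of consecutive edges (a trivial gallery is a single chamber with no edges), with initial chamber $\iota(\beta)$, terminal chamber $\tau(\beta)$, type $\beta_S$ (the word of types of its edges), and $W$-length $\beta_W\in W$ (the element represented by $\beta_S$). It is a cycle if $\iota(\beta)=\tau(\beta)$, and a geodesic if $\beta_S$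 is reduced. For $s\neq t$ with $m_{st}<\infty$: a maximal $(s,t)$-geodesic is a gallery of type $p(s,t)$; an $(s,t)$-cycle is a cycle of type $p_{2m_{st}}(s,t)$. Weyl data of type $M$ is a generalized chamber system of type $M$ together with, for each ordered pair $(s,t)$ with $s\neq t$, $m_{st}<\infty$, a set of $(s,t)$-cycles called defining suites. It is connected if any two chambers are joined by a gallery. Homotopy. Elementary homotopies of galleries are the following moves on subgalleries and their inverses: delete $i\,i^{-1}$; replace $i\,i'$ ($i,i'$ of the same type, $i'\ne i^{-1}$) by the single edge $i;i'$; delete a defining suite. Galleries are homotopic ($\sim$) if related by finitely many such moves. The fundamental groupoid $\overline{\mathcal W}$ has vertices the chambers and edges the homotopy classes $[\beta]$ of galleries, with $[\beta];[\beta']=[\beta\beta']$. A pre-Weyl graph is Weyl data satisfying (PW0) no panel is a trivial groupoid (one vertex, one edge), and (PW1) each maximal $(s,t)$-geodesic is homotopic to a maximal $(t,s)$-geodesic. A Weyl graph is a pre-Weyl graph satisfying (W) homotopic geodesics have the same $W$-length. Generating set. For each $s\in S$ choose one base chamber in each connected component of $\mathcal W_s$; let $B_s=\{B_{s,k}\}_k$ be the set of these, and let $\mathcal B_s$ be the set of non-identity edges of $\mathcal W_s$ from a chamber of $B_s$ to itself. For each chamber $C\notin B_s$ choose an edge $i_C$ of $\mathcal W_s$ from a chamber of $B_s$ to $C$. Put $\mathcal I_s^+=\{i_C:C\in\mathcal W_0\setminus B_s\}$, $\mathcal I_s^-=\{i_C^{-1}:C\in\mathcal W_0\setminus B_s\}$,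 and $\mathcal B=\bigsqcup_s\mathcal B_s$, $\mathcal I^\pm=\bigsqcup_s\mathcal I_s^\pm$, $\mathcal I=\mathcal I^+\sqcup\mathcal I^-$. A generating set of $\mathcal W$ is $\mathcal S=\mathcal B\sqcup\mathcal I$ for such choices. Each edge $i$ of type $s$ is uniquely $i=i^-;i_{\mathcal B};i^+$ in $\mathcal W_s$ with each of $i^-\in\mathcal I_s^-$, $i_{\mathcal B}\in\mathcal B_s$, $i^+\in\mathcal I_s^+$ or trivial; the expression of $i$ is the word over $\mathcal S$ obtained from $i^-,i_{\mathcal B},i^+$ by deleting trivial entries. Let $\mathcal R$ be the set of words over $\mathcal S$ obtained from the edge sequences of the defining suites of $\mathcal W$ by replacing each edge by its expression. Let $\mathcal R_{\mathcal B}=\bigsqcup_{s,k}\mathcal R_{s,k}$, where $\mathcal R_{s,k}$ is a set of defining relations, in the generators consisting of all non-identity elements, for the local group of $\mathcal W_s$ at $B_{s,k}$. Spanning tree and $\pi_1(\mathcal W,T)$. Let $\Gamma$ be the undirected graph with vertices the chambers and edges the sets $\{i,i^{-1}\}$, $i\in\mathcal I^+$, joining $\iota(i)$ and $\tau(i)$ (it is connected). A spanning tree $T$ of $\mathcal W$ is the set of all $i\in\mathcal I$ contained in some edge of a given spanning tree of $\Gamma$. Then $$\pi_1(\mathcal W,T):=\big\langle\,\mathcal S\ \big|\ \mathcal R,\ \mathcal R_{\mathcal B},\ ij=1,\ t=1\ :\ i\in\mathcal I^+,\ j=i^{-1}\in\mathcal I^-,\ t\in T\,\big\rangle,$$ where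 words in $\mathcal R$ are treated as relators. *)

theory Defs
  imports Main "HOL-Library.Extended_Nat" "HOL-Algebra.Group"
begin

section \<open>Groups given by generators and relations\<close>

text \<open>A letter \<open>(x, True)\<close> stands for the generator \<open>x\<close>, a letter \<open>(x, False)\<close> for its formal
  inverse. A relation \<open>l = r\<close> is the pair \<open>(l, r)\<close>; a relator \<open>w\<close> is the relation \<open>(w, [])\<close>.\<close>

type_synonym 'a gword = "('a \<times> bool) list"

definition gwords :: "'a set \<Rightarrow> 'a gword set" where
  "gwords X = lists (X \<times> UNIV)"

definition pos_word :: "'a list \<Rightarrow> 'a gword" where
  "pos_word w = map (\<lambda>x. (x, True)) w"

inductive_set pres_cong :: "'a set \<Rightarrow> ('a gword \<times> 'a gword) set \<Rightarrow> ('a gword \<times> 'a gword) set"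
  for X :: "'a set" and R :: "('a gword \<times> 'a gword) set" where
  refl: "w \<in> gwords X \<Longrightarrow> (w, w) \<in> pres_cong X R"
| sym: "(v, w) \<in> pres_cong X R \<Longrightarrow> (w, v) \<in> pres_cong X R"
| trans: "(u, v) \<in> pres_cong X R \<Longrightarrow> (v, w) \<in> pres_cong X R \<Longrightarrow> (u, w) \<in> pres_cong X R"
| mult: "(v, w) \<in> pres_cong X R \<Longrightarrow> (v', w') \<in> pres_cong X R \<Longrightarrow> (v @ v', w @ w') \<in> pres_cong X R"
| cancel: "x \<in> X \<Longrightarrow> ([(x, b), (x, \<not> b)], []) \<in> pres_cong X R"
| relation: "(l, r) \<in> R \<Longrightarrow> l \<in> gwords X \<Longrightarrow> r \<in> gwords X \<Longrightarrow> (l, r) \<in> pres_cong X R"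

definition pres_class :: "'a set \<Rightarrow> ('a gword \<times> 'a gword) set \<Rightarrow> 'a gword \<Rightarrow> 'a gword set" where
  "pres_class X R w = pres_cong X R `` {w}"

definition presented_group :: "'a set \<Rightarrow> ('a gword \<times> 'a gword) set \<Rightarrow> 'a gword set monoid" where
  "presented_group X R =
    \<lparr> carrier = gwords X // pres_cong X R,
      mult = (\<lambda>A B. \<Union>u\<in>A. \<Union>v\<in>B. pres_class X R (u @ v)),
      one = pres_class X R [] \<rparr>"

definition defining_relations ::
  "('a, 'b) monoid_scheme \<Rightarrow> 'a set \<Rightarrow> ('a gword \<times> 'a gword) set \<Rightarrow> bool" where
  "defining_relations G X R \<longleftrightarrow>
    X \<subseteq> carrier G \<and> R \<subseteq> gwords X \<times> gwords X \<and>
    (\<exists>h\<in>iso (presented_group X R) G. \<forall>x\<in>X. h (pres_class X R [(x, True)]) = x)"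


section \<open>Coxeter groups\<close>

definition coxeter_matrix :: "'s set \<Rightarrow> ('s \<Rightarrow> 's \<Rightarrow> enat) \<Rightarrow> bool" where
  "coxeter_matrix S M \<longleftrightarrow> finite S \<and>
    (\<forall>s\<in>S. M s s = 1) \<and>
    (\<forall>s\<in>S. \<forall>t\<in>S. M s t = M t s) \<and>
    (\<forall>s\<in>S. \<forall>t\<in>S. s \<noteq> t \<longrightarrow> 2 \<le> M s t)"

definition coxeter_relations :: "'s set \<Rightarrow> ('s \<Rightarrow> 's \<Rightarrow> enat) \<Rightarrow> ('s gword \<times> 's gword) set" where
  "coxeter_relations S M =
    {(pos_word (concat (replicate (the_enat (M s t)) [s, t])), []) | s t.
      s \<in> S \<and> t \<in> S \<and> M s t < \<infinity>}"

definition coxeter_group :: "'s set \<Rightarrow> ('s \<Rightarrow> 's \<Rightarrow> enat) \<Rightarrow> 's gword set monoid" where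
  "coxeter_group S M = presented_group S (coxeter_relations S M)"

definition cox_element :: "'s set \<Rightarrow> ('s \<Rightarrow> 's \<Rightarrow> enat) \<Rightarrow> 's list \<Rightarrow> 's gword set" where
  "cox_element S M w = pres_class S (coxeter_relations S M) (pos_word w)"

definition reduced_word :: "'s set \<Rightarrow> ('s \<Rightarrow> 's \<Rightarrow> enat) \<Rightarrow> 's list \<Rightarrow> bool" where
  "reduced_word S M w \<longleftrightarrow> w \<in> lists S \<and>
    \<not> (\<exists>v\<in>lists S. length v < length w \<and> cox_element S M v = cox_element S M w)"

fun alt_word :: "nat \<Rightarrow> 's \<Rightarrow> 's \<Rightarrow> 's list" where
  "alt_word 0 s t = []"
| "alt_word (Suc n) s t = s # alt_word n t s"


section \<open>Groupoids\<close>

text \<open>\<open>gcomp G g h\<close> is the composite written from left to right, relevant if \<open>gtrg G g = gsrc G h\<close>.\<close>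

record ('c, 'e) groupoid =
  gverts :: "'c set"
  garcs :: "'e set"
  gsrc :: "'e \<Rightarrow> 'c"
  gtrg :: "'e \<Rightarrow> 'c"
  gcomp :: "'e \<Rightarrow> 'e \<Rightarrow> 'e"
  gid :: "'c \<Rightarrow> 'e"

definition is_groupoid :: "('c, 'e) groupoid \<Rightarrow> bool" where
  "is_groupoid G \<longleftrightarrow> gverts G \<noteq> {} \<and>
    (\<forall>g\<in>garcs G. gsrc G g \<in> gverts G \<and> gtrg G g \<in> gverts G) \<and>
    (\<forall>x\<in>gverts G. gid G x \<in> garcs G \<and> gsrc G (gid G x) = x \<and> gtrg G (gid G x) = x) \<and>
    (\<forall>g\<in>garcs G. \<forall>h\<in>garcs G. gtrg G g = gsrc G h \<longrightarrow>
      gcomp G g h \<in> garcs G \<and> gsrc G (gcomp G g h) = gsrc G g \<and> gtrg G (gcomp G g h) = gtrg G h) \<and>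
    (\<forall>g\<in>garcs G. \<forall>h\<in>garcs G. \<forall>k\<in>garcs G. gtrg G g = gsrc G h \<and> gtrg G h = gsrc G k \<longrightarrow>
      gcomp G (gcomp G g h) k = gcomp G g (gcomp G h k)) \<and>
    (\<forall>g\<in>garcs G. gcomp G (gid G (gsrc G g)) g = g \<and> gcomp G g (gid G (gtrg G g)) = g) \<and>
    (\<forall>g\<in>garcs G. \<exists>h\<in>garcs G. gsrc G h = gtrg G g \<and> gtrg G h = gsrc G g \<and>
      gcomp G g h = gid G (gsrc G g) \<and> gcomp G h g = gid G (gtrg G g))"

definition gids :: "('c, 'e) groupoid \<Rightarrow> 'e set" where
  "gids G = gid G ` gverts G"

definition ginv :: "('c, 'e) groupoid \<Rightarrow> 'e \<Rightarrow> 'e" where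
  "ginv G g = (THE h. h \<in> garcs G \<and> gsrc G h = gtrg G g \<and> gtrg G h = gsrc G g \<and>
    gcomp G g h = gid G (gsrc G g) \<and> gcomp G h g = gid G (gtrg G g))"

definition local_group :: "('c, 'e) groupoid \<Rightarrow> 'c \<Rightarrow> 'e monoid" where
  "local_group G x =
    \<lparr> carrier = {g \<in> garcs G. gsrc G g = x \<and> gtrg G g = x}, mult = gcomp G, one = gid G x \<rparr>"

definition component_verts :: "('c, 'e) groupoid \<Rightarrow> 'c \<Rightarrow> 'c set" where
  "component_verts G x = {y. \<exists>g\<in>garcs G. gsrc G g = x \<and> gtrg G g = y}"

definition components :: "('c, 'e) groupoid \<Rightarrow> ('c, 'e) groupoid set" where
  "components G =
    {G\<lparr>gverts := component_verts G x, garcs := {g \<in> garcs G. gsrc G g \<in> component_verts G x}\<rparr> | x.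
      x \<in> gverts G}"

definition trivial_groupoid :: "('c, 'e) groupoid \<Rightarrow> bool" where
  "trivial_groupoid G \<longleftrightarrow> (\<exists>x. gverts G = {x}) \<and> (\<exists>g. garcs G = {g})"


section \<open>Weyl data\<close>

text \<open>Edges of the chamber system are tagged with their type, so that edges of different types are
  distinct. A gallery is its initial chamber together with its sequence of edges.\<close>

type_synonym ('s, 'c, 'e) gallery = "'c \<times> ('s \<times> 'e) list"

record ('s, 'c, 'e) weyl_data =
  chambers :: "'c set"
  panels :: "'s \<Rightarrow> ('c, 'e) groupoid"
  suites :: "'s \<Rightarrow> 's \<Rightarrow> ('s, 'c, 'e) gallery set"

definition chamber_system :: "'s set \<Rightarrow> ('s, 'c, 'e) weyl_data \<Rightarrow> bool" where
  "chamber_system S W \<longleftrightarrow> chambers W \<noteq> {} \<and>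
    (\<forall>s\<in>S. is_groupoid (panels W s) \<and> gverts (panels W s) = chambers W)"

definition edges :: "'s set \<Rightarrow> ('s, 'c, 'e) weyl_data \<Rightarrow> ('s \<times> 'e) set" where
  "edges S W = {(s, e). s \<in> S \<and> e \<in> garcs (panels W s) \<and> e \<notin> gids (panels W s)}"

definition esrc :: "('s, 'c, 'e) weyl_data \<Rightarrow> 's \<times> 'e \<Rightarrow> 'c" where
  "esrc W i = gsrc (panels W (fst i)) (snd i)"

definition etrg :: "('s, 'c, 'e) weyl_data \<Rightarrow> 's \<times> 'e \<Rightarrow> 'c" where
  "etrg W i = gtrg (panels W (fst i)) (snd i)"

definition einv :: "('s, 'c, 'e) weyl_data \<Rightarrow> 's \<times> 'e \<Rightarrow> 's \<times> 'e" where
  "einv W i = (fst i, ginv (panels W (fst i)) (snd i))"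

fun is_path :: "'s set \<Rightarrow> ('s, 'c, 'e) weyl_data \<Rightarrow> 'c \<Rightarrow> ('s \<times> 'e) list \<Rightarrow> bool" where
  "is_path S W x [] \<longleftrightarrow> x \<in> chambers W"
| "is_path S W x (i # is) \<longleftrightarrow> i \<in> edges S W \<and> esrc W i = x \<and> is_path S W (etrg W i) is"

definition galleries :: "'s set \<Rightarrow> ('s, 'c, 'e) weyl_data \<Rightarrow> ('s, 'c, 'e) gallery set" where
  "galleries S W = {(x, is). is_path S W x is}"

definition gal_init :: "('s, 'c, 'e) gallery \<Rightarrow> 'c" where
  "gal_init \<beta> = fst \<beta>"

definition gal_term :: "('s, 'c, 'e) weyl_data \<Rightarrow> ('s, 'c, 'e) gallery \<Rightarrow> 'c" where
  "gal_term W \<beta> = (if snd \<beta> = [] then fst \<beta> else etrg W (last (snd \<beta>)))"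

definition gal_append :: "('s, 'c, 'e) gallery \<Rightarrow> ('s, 'c, 'e) gallery \<Rightarrow> ('s, 'c, 'e) gallery" where
  "gal_append \<beta> \<gamma> = (fst \<beta>, snd \<beta> @ snd \<gamma>)"

definition gal_type :: "('s, 'c, 'e) gallery \<Rightarrow> 's list" where
  "gal_type \<beta> = map fst (snd \<beta>)"

definition gal_length :: "'s set \<Rightarrow> ('s \<Rightarrow> 's \<Rightarrow> enat) \<Rightarrow> ('s, 'c, 'e) gallery \<Rightarrow> 's gword set" where
  "gal_length S M \<beta> = cox_element S M (gal_type \<beta>)"

definition geodesic ::
  "'s set \<Rightarrow> ('s \<Rightarrow> 's \<Rightarrow> enat) \<Rightarrow> ('s, 'c, 'e) weyl_data \<Rightarrow> ('s, 'c, 'e) gallery \<Rightarrow> bool" where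
  "geodesic S M W \<beta> \<longleftrightarrow> \<beta> \<in> galleries S W \<and> reduced_word S M (gal_type \<beta>)"

definition spherical_pairs :: "'s set \<Rightarrow> ('s \<Rightarrow> 's \<Rightarrow> enat) \<Rightarrow> ('s \<times> 's) set" where
  "spherical_pairs S M = {(s, t). s \<in> S \<and> t \<in> S \<and> s \<noteq> t \<and> M s t < \<infinity>}"

definition maximal_geodesics ::
  "'s set \<Rightarrow> ('s \<Rightarrow> 's \<Rightarrow> enat) \<Rightarrow> ('s, 'c, 'e) weyl_data \<Rightarrow> 's \<Rightarrow> 's \<Rightarrow> ('s, 'c, 'e) gallery set" where
  "maximal_geodesics S M W s t =
    {\<beta> \<in> galleries S W. gal_type \<beta> = alt_word (the_enat (M s t)) s t}"

definition st_cycles ::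
  "'s set \<Rightarrow> ('s \<Rightarrow> 's \<Rightarrow> enat) \<Rightarrow> ('s, 'c, 'e) weyl_data \<Rightarrow> 's \<Rightarrow> 's \<Rightarrow> ('s, 'c, 'e) gallery set" where
  "st_cycles S M W s t =
    {\<beta> \<in> galleries S W. gal_init \<beta> = gal_term W \<beta> \<and>
      gal_type \<beta> = alt_word (2 * the_enat (M s t)) s t}"

definition is_weyl_data :: "'s set \<Rightarrow> ('s \<Rightarrow> 's \<Rightarrow> enat) \<Rightarrow> ('s, 'c, 'e) weyl_data \<Rightarrow> bool" where
  "is_weyl_data S M W \<longleftrightarrow> chamber_system S W \<and>
    (\<forall>(s, t)\<in>spherical_pairs S M. suites W s t \<subseteq> st_cycles S M W s t)"

definition defining_suites ::
  "'s set \<Rightarrow> ('s \<Rightarrow> 's \<Rightarrow> enat) \<Rightarrow> ('s, 'c, 'e) weyl_data \<Rightarrow> ('s, 'c, 'e) gallery set" where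
  "defining_suites S M W = (\<Union>(s, t)\<in>spherical_pairs S M. suites W s t)"

definition connected_weyl :: "'s set \<Rightarrow> ('s, 'c, 'e) weyl_data \<Rightarrow> bool" where
  "connected_weyl S W \<longleftrightarrow>
    (\<forall>x\<in>chambers W. \<forall>y\<in>chambers W. \<exists>\<beta>\<in>galleries S W. gal_init \<beta> = x \<and> gal_term W \<beta> = y)"


section \<open>Homotopy\<close>

inductive_set elem_homotopy ::
  "'s set \<Rightarrow> ('s \<Rightarrow> 's \<Rightarrow> enat) \<Rightarrow> ('s, 'c, 'e) weyl_data \<Rightarrow>
    (('s, 'c, 'e) gallery \<times> ('s, 'c, 'e) gallery) set"
  for S :: "'s set" and M :: "'s \<Rightarrow> 's \<Rightarrow> enat" and W :: "('s, 'c, 'e) weyl_data" where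
  backtrack: "(x, u @ [i, einv W i] @ v) \<in> galleries S W \<Longrightarrow>
    ((x, u @ [i, einv W i] @ v), (x, u @ v)) \<in> elem_homotopy S M W"
| merge: "(x, u @ [(s, i), (s, i')] @ v) \<in> galleries S W \<Longrightarrow> i' \<noteq> ginv (panels W s) i \<Longrightarrow>
    ((x, u @ [(s, i), (s, i')] @ v), (x, u @ [(s, gcomp (panels W s) i i')] @ v))
      \<in> elem_homotopy S M W"
| suite: "(x, u @ snd \<delta> @ v) \<in> galleries S W \<Longrightarrow> \<delta> \<in> defining_suites S M W \<Longrightarrow>
    ((x, u @ snd \<delta> @ v), (x, u @ v)) \<in> elem_homotopy S M W"

definition homotopy ::
  "'s set \<Rightarrow> ('s \<Rightarrow> 's \<Rightarrow> enat) \<Rightarrow> ('s, 'c, 'e) weyl_data \<Rightarrow>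
    (('s, 'c, 'e) gallery \<times> ('s, 'c, 'e) gallery) set" where
  "homotopy S M W =
    (elem_homotopy S M W \<union> (elem_homotopy S M W)\<inverse>)\<^sup>* \<inter> galleries S W \<times> galleries S W"

definition hclass ::
  "'s set \<Rightarrow> ('s \<Rightarrow> 's \<Rightarrow> enat) \<Rightarrow> ('s, 'c, 'e) weyl_data \<Rightarrow> ('s, 'c, 'e) gallery \<Rightarrow>
    ('s, 'c, 'e) gallery set" where
  "hclass S M W \<beta> = homotopy S M W `` {\<beta>}"

text \<open>Homotopic galleries have the same end points, so the choices of representatives in the end
  points of a class are immaterial.\<close>

definition fundamental_groupoid ::
  "'s set \<Rightarrow> ('s \<Rightarrow> 's \<Rightarrow> enat) \<Rightarrow> ('s, 'c, 'e) weyl_data \<Rightarrow> ('c, ('s, 'c, 'e) gallery set) groupoid" where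
  "fundamental_groupoid S M W =
    \<lparr> gverts = chambers W,
      garcs = galleries S W // homotopy S M W,
      gsrc = (\<lambda>A. gal_init (SOME \<beta>. \<beta> \<in> A)),
      gtrg = (\<lambda>A. gal_term W (SOME \<beta>. \<beta> \<in> A)),
      gcomp = (\<lambda>A B. \<Union>\<beta>\<in>A. \<Union>\<gamma>\<in>B. hclass S M W (gal_append \<beta> \<gamma>)),
      gid = (\<lambda>x. hclass S M W (x, [])) \<rparr>"


section \<open>Weyl graphs\<close>

definition pre_weyl_graph :: "'s set \<Rightarrow> ('s \<Rightarrow> 's \<Rightarrow> enat) \<Rightarrow> ('s, 'c, 'e) weyl_data \<Rightarrow> bool" where
  "pre_weyl_graph S M W \<longleftrightarrow> is_weyl_data S M W \<and>
    (\<forall>s\<in>S. \<forall>P\<in>components (panels W s). \<not> trivial_groupoid P) \<and>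
    (\<forall>(s, t)\<in>spherical_pairs S M. \<forall>\<beta>\<in>maximal_geodesics S M W s t.
      \<exists>\<gamma>\<in>maximal_geodesics S M W t s. (\<beta>, \<gamma>) \<in> homotopy S M W)"

definition weyl_graph :: "'s set \<Rightarrow> ('s \<Rightarrow> 's \<Rightarrow> enat) \<Rightarrow> ('s, 'c, 'e) weyl_data \<Rightarrow> bool" where
  "weyl_graph S M W \<longleftrightarrow> pre_weyl_graph S M W \<and>
    (\<forall>\<beta> \<gamma>. geodesic S M W \<beta> \<and> geodesic S M W \<gamma> \<and> (\<beta>, \<gamma>) \<in> homotopy S M W \<longrightarrow>
      gal_length S M \<beta> = gal_length S M \<gamma>)"


section \<open>Generating sets\<close>

text \<open>\<open>base s\<close> consists of the base chambers, one for each \<open>s\<close>-panel, and \<open>star s C\<close> is the chosen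
  edge of type \<open>s\<close> from a base chamber to \<open>C\<close>; it is only relevant for \<open>C \<notin> base s\<close>.\<close>

record ('s, 'c, 'e) gen_data =
  base :: "'s \<Rightarrow> 'c set"
  star :: "'s \<Rightarrow> 'c \<Rightarrow> 'e"

definition is_gen_data ::
  "'s set \<Rightarrow> ('s, 'c, 'e) weyl_data \<Rightarrow> ('s, 'c, 'e) gen_data \<Rightarrow> bool" where
  "is_gen_data S W D \<longleftrightarrow>
    (\<forall>s\<in>S. base D s \<subseteq> chambers W \<and>
      (\<forall>P\<in>components (panels W s). \<exists>!b. b \<in> base D s \<and> b \<in> gverts P) \<and>
      (\<forall>C\<in>chambers W - base D s. star D s C \<in> garcs (panels W s) \<and>
        gsrc (panels W s) (star D s C) \<in> base D s \<and> gtrg (panels W s) (star D s C) = C))"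

definition base_loops :: "('s, 'c, 'e) weyl_data \<Rightarrow> ('s, 'c, 'e) gen_data \<Rightarrow> 's \<Rightarrow> 'e set" where
  "base_loops W D s = {e \<in> garcs (panels W s). e \<notin> gids (panels W s) \<and>
    gsrc (panels W s) e \<in> base D s \<and> gtrg (panels W s) e = gsrc (panels W s) e}"

definition star_pos :: "('s, 'c, 'e) weyl_data \<Rightarrow> ('s, 'c, 'e) gen_data \<Rightarrow> 's \<Rightarrow> 'e set" where
  "star_pos W D s = star D s ` (chambers W - base D s)"

definition star_neg :: "('s, 'c, 'e) weyl_data \<Rightarrow> ('s, 'c, 'e) gen_data \<Rightarrow> 's \<Rightarrow> 'e set" where
  "star_neg W D s = ginv (panels W s) ` star_pos W D s"

definition gens_loops ::
  "'s set \<Rightarrow> ('s, 'c, 'e) weyl_data \<Rightarrow> ('s, 'c, 'e) gen_data \<Rightarrow> ('s \<times> 'e) set" where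
  "gens_loops S W D = (SIGMA s:S. base_loops W D s)"

definition gens_pos ::
  "'s set \<Rightarrow> ('s, 'c, 'e) weyl_data \<Rightarrow> ('s, 'c, 'e) gen_data \<Rightarrow> ('s \<times> 'e) set" where
  "gens_pos S W D = (SIGMA s:S. star_pos W D s)"

definition gens_neg ::
  "'s set \<Rightarrow> ('s, 'c, 'e) weyl_data \<Rightarrow> ('s, 'c, 'e) gen_data \<Rightarrow> ('s \<times> 'e) set" where
  "gens_neg S W D = (SIGMA s:S. star_neg W D s)"

definition generating_set ::
  "'s set \<Rightarrow> ('s, 'c, 'e) weyl_data \<Rightarrow> ('s, 'c, 'e) gen_data \<Rightarrow> ('s \<times> 'e) set" where
  "generating_set S W D = gens_loops S W D \<union> (gens_pos S W D \<union> gens_neg S W D)"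

text \<open>The factors \<open>i\<^sup>-\<close>, \<open>i\<^sub>B\<close>, \<open>i\<^sup>+\<close> of an edge; they exist and are unique for each edge, that is, for
  each non-identity arrow.\<close>

definition factors ::
  "('s, 'c, 'e) weyl_data \<Rightarrow> ('s, 'c, 'e) gen_data \<Rightarrow> 's \<times> 'e \<Rightarrow> 'e \<times> 'e \<times> 'e" where
  "factors W D i = (let G = panels W (fst i) in
    (THE (a, b, c).
      a \<in> star_neg W D (fst i) \<union> gids G \<and>
      b \<in> base_loops W D (fst i) \<union> gids G \<and>
      c \<in> star_pos W D (fst i) \<union> gids G \<and>
      gtrg G a = gsrc G b \<and> gtrg G b = gsrc G c \<and>
      gcomp G (gcomp G a b) c = snd i))"

definition edge_expr ::
  "('s, 'c, 'e) weyl_data \<Rightarrow> ('s, 'c, 'e) gen_data \<Rightarrow> 's \<times> 'e \<Rightarrow> ('s \<times> 'e) list" where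
  "edge_expr W D i = (case factors W D i of (a, b, c) \<Rightarrow>
    map (Pair (fst i)) (filter (\<lambda>e. e \<notin> gids (panels W (fst i))) [a, b, c]))"

definition gal_expr ::
  "('s, 'c, 'e) weyl_data \<Rightarrow> ('s, 'c, 'e) gen_data \<Rightarrow> ('s, 'c, 'e) gallery \<Rightarrow> ('s \<times> 'e) list" where
  "gal_expr W D \<beta> = concat (map (edge_expr W D) (snd \<beta>))"


section \<open>Spanning trees\<close>

text \<open>Undirected multigraphs: parallel edges are allowed, since chambers may be joined by edges of
  several types. A cycle of length two consists of two distinct parallel edges.\<close>

record ('v, 'a) multigraph =
  mg_verts :: "'v set"
  mg_edges :: "'a set"
  mg_ends :: "'a \<Rightarrow> 'v set"

fun mg_walk :: "('v, 'a) multigraph \<Rightarrow> 'v \<Rightarrow> 'a list \<Rightarrow> 'v \<Rightarrow> bool" where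
  "mg_walk G x [] y \<longleftrightarrow> x \<in> mg_verts G \<and> x = y"
| "mg_walk G x (a # as) y \<longleftrightarrow> a \<in> mg_edges G \<and> (\<exists>z. mg_ends G a = {x, z} \<and> mg_walk G z as y)"

definition mg_connected :: "('v, 'a) multigraph \<Rightarrow> bool" where
  "mg_connected G \<longleftrightarrow> (\<forall>x\<in>mg_verts G. \<forall>y\<in>mg_verts G. \<exists>as. mg_walk G x as y)"

definition mg_cycle :: "('v, 'a) multigraph \<Rightarrow> 'v list \<Rightarrow> 'a list \<Rightarrow> bool" where
  "mg_cycle G vs as \<longleftrightarrow> as \<noteq> [] \<and> length vs = length as \<and> distinct vs \<and> distinct as \<and>
    set vs \<subseteq> mg_verts G \<and> set as \<subseteq> mg_edges G \<and>
    (\<forall>k<length as. mg_ends G (as ! k) = {vs ! k, vs ! (Suc k mod length as)})"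

definition mg_tree :: "('v, 'a) multigraph \<Rightarrow> bool" where
  "mg_tree G \<longleftrightarrow> mg_connected G \<and> \<not> (\<exists>vs as. mg_cycle G vs as)"

definition mg_spanning_tree :: "('v, 'a) multigraph \<Rightarrow> 'a set \<Rightarrow> bool" where
  "mg_spanning_tree G F \<longleftrightarrow> F \<subseteq> mg_edges G \<and> mg_tree (G\<lparr>mg_edges := F\<rparr>)"

definition star_graph ::
  "'s set \<Rightarrow> ('s, 'c, 'e) weyl_data \<Rightarrow> ('s, 'c, 'e) gen_data \<Rightarrow> ('c, ('s \<times> 'e) set) multigraph" where
  "star_graph S W D =
    \<lparr> mg_verts = chambers W,
      mg_edges = {{i, einv W i} | i. i \<in> gens_pos S W D},
      mg_ends = (\<lambda>a. esrc W ` a \<union> etrg W ` a) \<rparr>"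

definition weyl_spanning_tree ::
  "'s set \<Rightarrow> ('s, 'c, 'e) weyl_data \<Rightarrow> ('s, 'c, 'e) gen_data \<Rightarrow> ('s \<times> 'e) set \<Rightarrow> bool" where
  "weyl_spanning_tree S W D T \<longleftrightarrow>
    (\<exists>F. mg_spanning_tree (star_graph S W D) F \<and>
      T = {i \<in> gens_pos S W D \<union> gens_neg S W D. \<exists>a\<in>F. i \<in> a})"


section \<open>The group of a spanning tree\<close>

text \<open>\<open>RB s b\<close> is the chosen set of defining relations of the local group of the panel groupoid of
  type \<open>s\<close> at the base chamber \<open>b\<close>, in the non-identity elements as generators.\<close>

definition is_base_relations ::
  "'s set \<Rightarrow> ('s, 'c, 'e) weyl_data \<Rightarrow> ('s, 'c, 'e) gen_data \<Rightarrow>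
    ('s \<Rightarrow> 'c \<Rightarrow> ('e gword \<times> 'e gword) set) \<Rightarrow> bool" where
  "is_base_relations S W D RB \<longleftrightarrow>
    (\<forall>s\<in>S. \<forall>b\<in>base D s. let H = local_group (panels W s) b in
      defining_relations H (carrier H - {\<one>\<^bsub>H\<^esub>}) (RB s b))"

definition tag_word :: "'s \<Rightarrow> 'e gword \<Rightarrow> ('s \<times> 'e) gword" where
  "tag_word s w = map (\<lambda>(e, p). ((s, e), p)) w"

definition suite_relations ::
  "'s set \<Rightarrow> ('s \<Rightarrow> 's \<Rightarrow> enat) \<Rightarrow> ('s, 'c, 'e) weyl_data \<Rightarrow> ('s, 'c, 'e) gen_data \<Rightarrow>
    (('s \<times> 'e) gword \<times> ('s \<times> 'e) gword) set" where
  "suite_relations S M W D =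
    {(pos_word (gal_expr W D \<delta>), []) | \<delta>. \<delta> \<in> defining_suites S M W}"

definition base_relations ::
  "'s set \<Rightarrow> ('s, 'c, 'e) gen_data \<Rightarrow> ('s \<Rightarrow> 'c \<Rightarrow> ('e gword \<times> 'e gword) set) \<Rightarrow>
    (('s \<times> 'e) gword \<times> ('s \<times> 'e) gword) set" where
  "base_relations S D RB =
    {(tag_word s l, tag_word s r) | s b l r. s \<in> S \<and> b \<in> base D s \<and> (l, r) \<in> RB s b}"

definition inverse_relations ::
  "'s set \<Rightarrow> ('s, 'c, 'e) weyl_data \<Rightarrow> ('s, 'c, 'e) gen_data \<Rightarrow>
    (('s \<times> 'e) gword \<times> ('s \<times> 'e) gword) set" where
  "inverse_relations S W D = {(pos_word [i, einv W i], []) | i. i \<in> gens_pos S W D}"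

definition tree_relations :: "('s \<times> 'e) set \<Rightarrow> (('s \<times> 'e) gword \<times> ('s \<times> 'e) gword) set" where
  "tree_relations T = {(pos_word [t], []) | t. t \<in> T}"

definition pi1_relations ::
  "'s set \<Rightarrow> ('s \<Rightarrow> 's \<Rightarrow> enat) \<Rightarrow> ('s, 'c, 'e) weyl_data \<Rightarrow> ('s, 'c, 'e) gen_data \<Rightarrow>
    ('s \<Rightarrow> 'c \<Rightarrow> ('e gword \<times> 'e gword) set) \<Rightarrow> ('s \<times> 'e) set \<Rightarrow>
    (('s \<times> 'e) gword \<times> ('s \<times> 'e) gword) set" where
  "pi1_relations S M W D RB T =
    suite_relations S M W D \<union> base_relations S D RB \<union> inverse_relations S W D \<union> tree_relations T"

definition pi1 ::
  "'s set \<Rightarrow> ('s \<Rightarrow> 's \<Rightarrow> enat) \<Rightarrow> ('s, 'c, 'e) weyl_data \<Rightarrow> ('s, 'c, 'e) gen_data \<Rightarrow>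
    ('s \<Rightarrow> 'c \<Rightarrow> ('e gword \<times> 'e gword) set) \<Rightarrow> ('s \<times> 'e) set \<Rightarrow> ('s \<times> 'e) gword set monoid" where
  "pi1 S M W D RB T = presented_group (generating_set S W D) (pi1_relations S M W D RB T)"

text \<open>The element of the group represented by (the edge sequence of) a gallery.\<close>

definition pi1_of_gallery ::
  "'s set \<Rightarrow> ('s \<Rightarrow> 's \<Rightarrow> enat) \<Rightarrow> ('s, 'c, 'e) weyl_data \<Rightarrow> ('s, 'c, 'e) gen_data \<Rightarrow>
    ('s \<Rightarrow> 'c \<Rightarrow> ('e gword \<times> 'e gword) set) \<Rightarrow> ('s \<times> 'e) set \<Rightarrow> ('s, 'c, 'e) gallery \<Rightarrow>
    ('s \<times> 'e) gword set" where
  "pi1_of_gallery S M W D RB T \<beta> =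
    pres_class (generating_set S W D) (pi1_relations S M W D RB T) (pos_word (gal_expr W D \<beta>))"

definition tree_galleries ::
  "'s set \<Rightarrow> ('s, 'c, 'e) weyl_data \<Rightarrow> ('s \<times> 'e) set \<Rightarrow> ('s, 'c, 'e) gallery set" where
  "tree_galleries S W T = {\<beta> \<in> galleries S W. set (snd \<beta>) \<subseteq> T}"

end

theory Submission
  imports Defs
begin

text \<open>Sending an edge to its expression gives a functor from each panel groupoid to the presented
  group: the relations at the base chambers handle loops there, and the relations \<open>ij = 1\<close> transport
  this along the star edges. Hence the expression of a gallery is invariant under homotopy. Conversely,
  fix a chamber \<open>x\<close> and send a generator \<open>i\<close> to the loop at \<open>x\<close> which runs through the tree to the start
  of \<open>i\<close>, follows \<open>i\<close>, and returns through the tree. All relations become null-homotopic loops; for the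
  tree relations this holds because a closed path in a tree is null-homotopic. The two assignments are
  mutually inverse on loops at \<open>x\<close>, as tree edges have trivial expressions.\<close>

section \<open>Presented groups\<close>

text \<open>Three points lie behind this plan. Identity arrows are not edges, so a functor on a
  panel groupoid has to be built although expressions exist only for edges; \<open>seg\<close> and
  \<open>arrow_word\<close> cover identities as well, and the word of an identity arrow is trivial
  because it is idempotent. The relations at the base chambers may be any defining relations, so
  nothing can be read off from their shape; both directions reach them through one evaluation map
  into the local group (\<open>base_eval\<close>), whose fibres are the congruence classes of words.
  Finally, the assignment on galleries is made on the whole fundamental groupoid, with values in a
  group seen as a groupoid with one vertex. One map therefore restricts to an isomorphism at every
  chamber, and since paths in the tree go to the unit, these isomorphisms are matched by conjugation
  along the tree; that is the meaning of naturality here.\<close>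

lemma gwords_simps [simp]:
  "[] \<in> gwords X"
  "a # w \<in> gwords X \<longleftrightarrow> fst a \<in> X \<and> w \<in> gwords X"
  "u @ v \<in> gwords X \<longleftrightarrow> u \<in> gwords X \<and> v \<in> gwords X"
  by (auto simp: gwords_def mem_Times_iff)

lemma pos_word_simps [simp]:
  "pos_word [] = []"
  "pos_word (x # w) = (x, True) # pos_word w"
  "pos_word (u @ v) = pos_word u @ pos_word v"
  by (simp_all add: pos_word_def)

lemma pos_word_in_gwords [simp]: "pos_word w \<in> gwords X \<longleftrightarrow> set w \<subseteq> X"
  by (induction w) auto

lemma pres_cong_in_gwords:
  assumes "(v, w) \<in> pres_cong X R"
  shows "v \<in> gwords X" "w \<in> gwords X"
  using assms by (induction rule: pres_cong.induct) auto

lemma equiv_pres_cong: "equiv (gwords X) (pres_cong X R)"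
proof (intro equivI refl_onI symI transI)
  show "pres_cong X R \<subseteq> gwords X \<times> gwords X"
    by (auto dest: pres_cong_in_gwords)
qed (fact pres_cong.refl pres_cong.sym pres_cong.trans)+

text \<open>A list that is not a word over \<open>X\<close> has the empty class, so equality of
  classes says something only for words. This is why membership in \<open>gwords X\<close>
  accompanies every later equation between classes.\<close>

lemma pres_class_eq_iff:
  assumes "u \<in> gwords X" "v \<in> gwords X"
  shows "pres_class X R u = pres_class X R v \<longleftrightarrow> (u, v) \<in> pres_cong X R"
  using eq_equiv_class_iff[OF equiv_pres_cong assms] by (simp add: pres_class_def)

lemma pres_class_eqI: "(u, v) \<in> pres_cong X R \<Longrightarrow> pres_class X R u = pres_class X R v"
  using pres_class_eq_iff pres_cong_in_gwords by blast

lemma pres_class_append_cong: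
  assumes "pres_class X R u = pres_class X R u'" "pres_class X R v = pres_class X R v'"
    and "u \<in> gwords X" "u' \<in> gwords X" "v \<in> gwords X" "v' \<in> gwords X"
  shows "pres_class X R (u @ v) = pres_class X R (u' @ v')"
  using assms by (simp add: pres_class_eq_iff pres_cong.mult)

lemma pres_class_context:
  assumes "pres_class X R v = pres_class X R v'"
    and "u \<in> gwords X" "v \<in> gwords X" "v' \<in> gwords X" "w \<in> gwords X"
  shows "pres_class X R (u @ v @ w) = pres_class X R (u @ v' @ w)"
  using assms by (intro pres_class_append_cong) auto

lemma pres_class_cancel:
  assumes "x \<in> X"
  shows "pres_class X R [(x, b), (x, \<not> b)] = pres_class X R []"
  using assms by (intro pres_class_eqI pres_cong.cancel)

lemma carrier_presented_group:
  "carrier (presented_group X R) = pres_class X R ` gwords X"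
  by (auto simp: presented_group_def quotient_def pres_class_def)

lemma mult_presented_group:
  assumes "u \<in> gwords X" "v \<in> gwords X"
  shows "pres_class X R u \<otimes>\<^bsub>presented_group X R\<^esub> pres_class X R v = pres_class X R (u @ v)"
proof -
  have "pres_class X R (u' @ v') = pres_class X R (u @ v)"
    if "u' \<in> pres_class X R u" "v' \<in> pres_class X R v" for u' v'
    using that by (intro pres_class_eqI pres_cong.mult)
      (auto simp: pres_class_def intro: pres_cong.sym)
  \<comment> \<open>The union over all representatives collapses to one class only because both
    index sets are non-empty.\<close>
  moreover have "u \<in> pres_class X R u" "v \<in> pres_class X R v"
    using assms by (auto simp: pres_class_def intro: pres_cong.refl)
  ultimately have "(\<Union>u'\<in>pres_class X R u. \<Union>v'\<in>pres_class X R v. pres_class X R (u' @ v')) =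
      pres_class X R (u @ v)"
    by blast
  then show ?thesis
    by (simp add: presented_group_def)
qed

text \<open>Renaming generators carries consequences of relations to consequences. With
  \<open>f = Pair s\<close> it moves equations from the presentation of a local group into the large
  presentation.\<close>

lemma pres_cong_map:
  assumes "(v, w) \<in> pres_cong X R" "f ` X \<subseteq> Y"
    and "\<And>l r. (l, r) \<in> R \<Longrightarrow> (map (map_prod f id) l, map (map_prod f id) r) \<in> pres_cong Y Q"
  shows "(map (map_prod f id) v, map (map_prod f id) w) \<in> pres_cong Y Q"
  using assms(1)
proof (induction rule: pres_cong.induct)
  case (refl w)
  have "map (map_prod f id) w \<in> gwords Y"
    using refl assms(2) by (induction w) auto
  then show ?case by (rule pres_cong.refl)
next
  case (cancel x b)
  then show ?case using assms(2) by (auto intro!: pres_cong.cancel)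
next
  case (relation l r)
  then show ?case using assms(3) by blast
next
  case (trans u v w)
  from trans.IH show ?case by (rule pres_cong.trans)
next
  case (mult v w v' w')
  then show ?case by (simp add: pres_cong.mult)
qed (rule pres_cong.sym)

section \<open>Groupoids\<close>

locale grpd =
  fixes G :: "('c, 'e) groupoid"
  assumes is_groupoid: "is_groupoid G"
begin

lemma src_in: "g \<in> garcs G \<Longrightarrow> gsrc G g \<in> gverts G"
  and trg_in: "g \<in> garcs G \<Longrightarrow> gtrg G g \<in> gverts G"
  and id_arc: "x \<in> gverts G \<Longrightarrow> gid G x \<in> garcs G"
  and src_id: "x \<in> gverts G \<Longrightarrow> gsrc G (gid G x) = x"
  and trg_id: "x \<in> gverts G \<Longrightarrow> gtrg G (gid G x) = x"
  using is_groupoid by (simp_all add: is_groupoid_def)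

lemma comp_arc: "\<lbrakk>g \<in> garcs G; h \<in> garcs G; gtrg G g = gsrc G h\<rbrakk> \<Longrightarrow> gcomp G g h \<in> garcs G"
  and src_comp: "\<lbrakk>g \<in> garcs G; h \<in> garcs G; gtrg G g = gsrc G h\<rbrakk> \<Longrightarrow> gsrc G (gcomp G g h) = gsrc G g"
  and trg_comp: "\<lbrakk>g \<in> garcs G; h \<in> garcs G; gtrg G g = gsrc G h\<rbrakk> \<Longrightarrow> gtrg G (gcomp G g h) = gtrg G h"
  using is_groupoid by (simp_all add: is_groupoid_def)

lemma comp_assoc:
  "\<lbrakk>g \<in> garcs G; h \<in> garcs G; k \<in> garcs G; gtrg G g = gsrc G h; gtrg G h = gsrc G k\<rbrakk>
    \<Longrightarrow> gcomp G (gcomp G g h) k = gcomp G g (gcomp G h k)"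
  using is_groupoid by (simp add: is_groupoid_def)

lemma id_comp: "g \<in> garcs G \<Longrightarrow> gcomp G (gid G (gsrc G g)) g = g"
  and comp_id: "g \<in> garcs G \<Longrightarrow> gcomp G g (gid G (gtrg G g)) = g"
  using is_groupoid by (simp_all add: is_groupoid_def)

lemma ex_inv:
  assumes "g \<in> garcs G"
  obtains h where "h \<in> garcs G" "gsrc G h = gtrg G g" "gtrg G h = gsrc G g"
    "gcomp G g h = gid G (gsrc G g)" "gcomp G h g = gid G (gtrg G g)"
  using is_groupoid assms unfolding is_groupoid_def by blast

text \<open>The usual argument that a left inverse \<open>k\<close> and a right inverse
  \<open>h\<close> agree; it makes the description in \<open>ginv\<close> well defined.\<close>

lemma right_inv_unique:
  assumes "g \<in> garcs G" "h \<in> garcs G" "k \<in> garcs G"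
    and "gsrc G h = gtrg G g" "gtrg G h = gsrc G g" "gsrc G k = gtrg G g" "gtrg G k = gsrc G g"
    and "gcomp G g h = gid G (gsrc G g)" "gcomp G k g = gid G (gtrg G g)"
  shows "k = h"
proof -
  have "k = gcomp G k (gcomp G g h)" using assms comp_id[of k] by simp
  also have "\<dots> = gcomp G (gcomp G k g) h" using assms comp_assoc[of k g h] by simp
  also have "\<dots> = h" using assms id_comp[of h] by simp
  finally show ?thesis .
qed

lemma ginv_props:
  assumes "g \<in> garcs G"
  shows inv_arc: "ginv G g \<in> garcs G"
    and src_inv: "gsrc G (ginv G g) = gtrg G g"
    and trg_inv: "gtrg G (ginv G g) = gsrc G g"
    and comp_inv: "gcomp G g (ginv G g) = gid G (gsrc G g)"
    and inv_comp: "gcomp G (ginv G g) g = gid G (gtrg G g)"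
proof -
  obtain h where h: "h \<in> garcs G" "gsrc G h = gtrg G g" "gtrg G h = gsrc G g"
    "gcomp G g h = gid G (gsrc G g)" "gcomp G h g = gid G (gtrg G g)"
    using ex_inv[OF assms] .
  have "\<exists>!h. h \<in> garcs G \<and> gsrc G h = gtrg G g \<and> gtrg G h = gsrc G g \<and>
      gcomp G g h = gid G (gsrc G g) \<and> gcomp G h g = gid G (gtrg G g)"
    using h right_inv_unique[OF assms] by (intro ex1I[of _ h]) auto
  from theI'[OF this]
  show "ginv G g \<in> garcs G" "gsrc G (ginv G g) = gtrg G g" "gtrg G (ginv G g) = gsrc G g"
    "gcomp G g (ginv G g) = gid G (gsrc G g)" "gcomp G (ginv G g) g = gid G (gtrg G g)"
    by (simp_all add: ginv_def)
qed

text \<open>One of the two inverse equations suffices, because \<open>ginv G g\<close> itself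
  supplies the other for \<open>right_inv_unique\<close>.\<close>

lemma ginv_eqI:
  assumes "g \<in> garcs G" "h \<in> garcs G" "gsrc G h = gtrg G g" "gtrg G h = gsrc G g"
    and "gcomp G g h = gid G (gsrc G g)"
  shows "ginv G g = h"
  using assms ginv_props[OF assms(1)] by (simp add: right_inv_unique[OF assms(1)])

lemma inv_inv: "g \<in> garcs G \<Longrightarrow> ginv G (ginv G g) = g"
  by (rule ginv_eqI) (auto simp: ginv_props)

lemma inv_id: "x \<in> gverts G \<Longrightarrow> ginv G (gid G x) = gid G x"
  using comp_id[of "gid G x"] by (auto intro!: ginv_eqI simp: id_arc src_id trg_id)

lemma inv_comp_cancel_left:
  "\<lbrakk>g \<in> garcs G; h \<in> garcs G; gsrc G g = gtrg G h\<rbrakk> \<Longrightarrow> gcomp G (ginv G h) (gcomp G h g) = g"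
  using id_comp[of g] by (simp add: comp_assoc[symmetric] ginv_props)

lemma gids_arc: "g \<in> gids G \<Longrightarrow> g \<in> garcs G"
  by (auto simp: gids_def id_arc)

lemma src_eq_trg_gids: "g \<in> gids G \<Longrightarrow> gtrg G g = gsrc G g"
  by (auto simp: gids_def src_id trg_id)

lemma inv_in_gids_iff: "g \<in> garcs G \<Longrightarrow> ginv G g \<in> gids G \<longleftrightarrow> g \<in> gids G"
proof -
  have inv: "ginv G h \<in> gids G" if "h \<in> gids G" for h
    using that by (auto simp: gids_def inv_id)
  show "ginv G g \<in> gids G \<longleftrightarrow> g \<in> gids G" if "g \<in> garcs G"
    using inv[of g] inv[of "ginv G g"] inv_inv[OF that] by auto
qed

lemma gids_comp: "\<lbrakk>g \<in> gids G; h \<in> garcs G; gtrg G g = gsrc G h\<rbrakk> \<Longrightarrow> gcomp G g h = h"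
  using id_comp[of h] by (auto simp: gids_def trg_id)

lemma comp_gids: "\<lbrakk>g \<in> garcs G; h \<in> gids G; gtrg G g = gsrc G h\<rbrakk> \<Longrightarrow> gcomp G g h = g"
  using comp_id[of g] by (auto simp: gids_def src_id)

text \<open>This is the origin of the side condition of the merge move: two composable edges of one
  type compose to an edge unless they are inverse to each other.\<close>

lemma comp_in_gids_iff:
  assumes "g \<in> garcs G" "h \<in> garcs G" "gtrg G g = gsrc G h"
  shows "gcomp G g h \<in> gids G \<longleftrightarrow> h = ginv G g"
proof
  assume "gcomp G g h \<in> gids G"
  then obtain x where "x \<in> gverts G" "gcomp G g h = gid G x"
    by (auto simp: gids_def)
  then have "gcomp G g h = gid G (gsrc G g)" "gtrg G h = gsrc G g"
    using src_comp[OF assms] trg_comp[OF assms] by (simp_all add: src_id trg_id)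
  then show "h = ginv G g" using assms ginv_eqI[of g h] by simp
next
  assume "h = ginv G g"
  then show "gcomp G g h \<in> gids G" using assms by (simp add: comp_inv gids_def src_in)
qed

end

section \<open>Galleries and homotopy\<close>

text \<open>The definition through \<open>last\<close> is traded for a recursion from the front,
  which runs parallel to \<open>is_path\<close>.\<close>

lemma gal_term_simps [simp]:
  "gal_term W (x, []) = x"
  "gal_term W (x, i # p) = gal_term W (etrg W i, p)"
  by (simp_all add: gal_term_def)

lemma gal_term_append [simp]: "gal_term W (x, p @ q) = gal_term W (gal_term W (x, p), q)"
  by (induction p arbitrary: x) auto

locale weyl_setup =
  fixes S :: "'s set" and M :: "'s \<Rightarrow> 's \<Rightarrow> enat" and W :: "('s, 'c, 'e) weyl_data"
  assumes weyl_data: "is_weyl_data S M W"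
begin

abbreviation path :: "'c \<Rightarrow> ('s \<times> 'e) list \<Rightarrow> bool" where
  "path \<equiv> is_path S W"

abbreviation hcl :: "'c \<Rightarrow> ('s \<times> 'e) list \<Rightarrow> ('s, 'c, 'e) gallery set" where
  "hcl x p \<equiv> hclass S M W (x, p)"

abbreviation FG :: "('c, ('s, 'c, 'e) gallery set) groupoid" where
  "FG \<equiv> fundamental_groupoid S M W"

lemma chamber_system: "chamber_system S W"
  using weyl_data by (simp add: is_weyl_data_def)

lemma panel_grpd: "s \<in> S \<Longrightarrow> grpd (panels W s)"
  using chamber_system by (simp add: chamber_system_def grpd_def)

lemma panel_verts: "s \<in> S \<Longrightarrow> gverts (panels W s) = chambers W"
  using chamber_system by (simp add: chamber_system_def)

lemma edges_iff:
  "i \<in> edges S W \<longleftrightarrow> fst i \<in> S \<and> snd i \<in> garcs (panels W (fst i)) \<and> snd i \<notin> gids (panels W (fst i))"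
  by (auto simp: edges_def)

lemma esrc_in: "i \<in> edges S W \<Longrightarrow> esrc W i \<in> chambers W"
  and etrg_in: "i \<in> edges S W \<Longrightarrow> etrg W i \<in> chambers W"
  using grpd.src_in[OF panel_grpd] grpd.trg_in[OF panel_grpd] panel_verts
  by (auto simp: edges_iff esrc_def etrg_def)

lemma fst_einv [simp]: "fst (einv W i) = fst i"
  by (simp add: einv_def)

lemma einv_props:
  assumes "i \<in> edges S W"
  shows einv_edge: "einv W i \<in> edges S W"
    and esrc_einv: "esrc W (einv W i) = etrg W i"
    and etrg_einv: "etrg W (einv W i) = esrc W i"
    and einv_einv: "einv W (einv W i) = i"
proof -
  interpret P: grpd "panels W (fst i)"
    using assms by (auto simp: edges_iff intro: panel_grpd)
  show "einv W i \<in> edges S W" "esrc W (einv W i) = etrg W i" "etrg W (einv W i) = esrc W i"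
    "einv W (einv W i) = i"
    using assms
    by (auto simp: edges_iff einv_def esrc_def etrg_def P.ginv_props P.inv_inv P.inv_in_gids_iff)
qed

lemma is_path_start: "path x p \<Longrightarrow> x \<in> chambers W"
  by (cases p) (auto simp: esrc_in)

lemma is_path_append [simp]: "path x (p @ q) \<longleftrightarrow> path x p \<and> path (gal_term W (x, p)) q"
  by (induction p arbitrary: x) (auto dest: is_path_start)

lemma is_path_end: "path x p \<Longrightarrow> gal_term W (x, p) \<in> chambers W"
  by (induction p arbitrary: x) auto

lemma is_path_edges: "path x p \<Longrightarrow> set p \<subseteq> edges S W"
  by (induction p arbitrary: x) auto

lemma in_galleries [simp]: "(x, p) \<in> galleries S W \<longleftrightarrow> path x p"
  by (simp add: galleries_def)

lemma defining_suite_closed: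
  assumes "\<delta> \<in> defining_suites S M W"
  shows "path (fst \<delta>) (snd \<delta>)" "gal_term W (fst \<delta>, snd \<delta>) = fst \<delta>"
proof -
  have "\<delta> \<in> galleries S W" "gal_init \<delta> = gal_term W \<delta>"
    using assms weyl_data by (auto simp: defining_suites_def is_weyl_data_def st_cycles_def)
  then show "path (fst \<delta>) (snd \<delta>)" "gal_term W (fst \<delta>, snd \<delta>) = fst \<delta>"
    by (cases \<delta>; simp add: gal_init_def)+
qed

lemma is_path_start_unique: "\<lbrakk>path x p; path y p; p \<noteq> []\<rbrakk> \<Longrightarrow> x = y"
  by (cases p) auto

text \<open>The rules for the moves only ask the longer side to be a gallery. For the shorter side
  this has to be derived: from the side condition in a merge, and from closedness for a
  suite.\<close>

lemma elem_homotopy_ends: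
  assumes "((x, p), (y, q)) \<in> elem_homotopy S M W"
  shows "y = x \<and> path x p \<and> path x q \<and> gal_term W (x, q) = gal_term W (x, p)"
  using assms
proof cases
  case (backtrack u i v)
  then show ?thesis
    by (auto simp: etrg_einv)
next
  case (merge u s i i' v)
  then interpret P: grpd "panels W s"
    by (auto simp: edges_iff intro: panel_grpd)
  show ?thesis
    using merge by (auto simp: edges_iff esrc_def etrg_def P.comp_arc P.src_comp P.trg_comp P.comp_in_gids_iff)
next
  case (suite u \<delta> v)
  show ?thesis
  \<comment> \<open>A gallery without edges fits at any chamber. As soon as there is an edge, the
    place where the suite is inserted must be its own initial chamber.\<close>
  proof (cases "snd \<delta> = []")
    case False
    have "path (gal_term W (x, u)) (snd \<delta>)" using suite by simp
    then have "gal_term W (x, u) = fst \<delta>"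
      using False defining_suite_closed(1)[OF \<open>\<delta> \<in> _\<close>] is_path_start_unique by blast
    then show ?thesis
      using suite defining_suite_closed[OF \<open>\<delta> \<in> _\<close>] by auto
  qed (use suite in auto)
qed

lemma elem_homotopy_context:
  assumes "((x, p), (x, q)) \<in> elem_homotopy S M W"
    and "path z u" "gal_term W (z, u) = x" "path (gal_term W (x, p)) v"
  shows "((z, u @ p @ v), (z, u @ q @ v)) \<in> elem_homotopy S M W"
  using assms(1)
proof cases
  case (backtrack u' i v')
  then show ?thesis
    using elem_homotopy.backtrack[where x = z and u = "u @ u'" and i = i and v = "v' @ v"] assms by auto
next
  case (merge u' s i i' v')
  then show ?thesis
    using elem_homotopy.merge[where x = z and u = "u @ u'" and v = "v' @ v"] assms by auto
next
  case (suite u' \<delta> v')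
  then show ?thesis
    using elem_homotopy.suite[where x = z and u = "u @ u'" and v = "v' @ v"] assms by auto
qed

text \<open>The end points and the compatibility with a context \<open>u\<close>, \<open>v\<close>
  go through one induction, since inserting the next move requires knowing where the intermediate
  gallery starts and ends. The context conditions stay implications, so that the part on end points
  is available without them.\<close>

lemma homotopic_context:
  assumes "((x, p), b) \<in> (elem_homotopy S M W \<union> (elem_homotopy S M W)\<inverse>)\<^sup>*" "path x p"
  shows "fst b = x \<and> path x (snd b) \<and> gal_term W (x, snd b) = gal_term W (x, p) \<and>
    (path z u \<longrightarrow> gal_term W (z, u) = x \<longrightarrow> path (gal_term W (x, p)) v \<longrightarrow>
      ((z, u @ p @ v), (z, u @ snd b @ v)) \<in> (elem_homotopy S M W \<union> (elem_homotopy S M W)\<inverse>)\<^sup>*)"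
  using assms(1)
proof (induction rule: rtrancl_induct)
  case base
  then show ?case using assms(2) by simp
next
  case (step b c)
  obtain q r where b: "b = (x, q)" and c: "c = (fst c, r)"
    using step.IH by (cases b; cases c) auto
  from step.hyps(2) have ends: "fst c = x \<and> path x r \<and> gal_term W (x, r) = gal_term W (x, q)"
    using elem_homotopy_ends[of x q "fst c" r] elem_homotopy_ends[of "fst c" r x q] b c by auto
  have "((z, u @ q @ v), (z, u @ r @ v)) \<in> elem_homotopy S M W \<union> (elem_homotopy S M W)\<inverse>"
    if "path z u" "gal_term W (z, u) = x" "path (gal_term W (x, p)) v"
    using step b c ends that elem_homotopy_context[of x q r z u v] elem_homotopy_context[of x r q z u v]
    by auto
  then show ?case
    using step.IH ends b c by (auto intro: rtrancl.rtrancl_into_rtrancl)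
qed

lemma homotopy_ends:
  assumes "((x, p), (y, q)) \<in> homotopy S M W"
  shows "y = x" "gal_term W (y, q) = gal_term W (x, p)"
  using assms homotopic_context[of x p "(y, q)"] by (auto simp: homotopy_def)

lemma equiv_homotopy: "equiv (galleries S W) (homotopy S M W)"
proof (intro equivI refl_onI symI transI)
  have "sym ((elem_homotopy S M W \<union> (elem_homotopy S M W)\<inverse>)\<^sup>*)"
    by (intro sym_rtrancl) (auto simp: sym_def)
  then show "(c, b) \<in> homotopy S M W" if "(b, c) \<in> homotopy S M W" for b c
    using that by (auto simp: homotopy_def dest: symD)
  show "(b, d) \<in> homotopy S M W" if "(b, c) \<in> homotopy S M W" "(c, d) \<in> homotopy S M W" for b c d
    using that by (auto simp: homotopy_def)
qed (auto simp: homotopy_def)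

lemma hclass_eq_iff:
  "\<lbrakk>b \<in> galleries S W; c \<in> galleries S W\<rbrakk> \<Longrightarrow>
    hclass S M W b = hclass S M W c \<longleftrightarrow> (b, c) \<in> homotopy S M W"
  using eq_equiv_class_iff[OF equiv_homotopy] by (simp add: hclass_def)

lemma hclass_eqD:
  assumes "hcl x p = hcl y q" "path x p" "path y q"
  shows "y = x" "gal_term W (y, q) = gal_term W (x, p)"
  using assms homotopy_ends[of x p y q] by (auto simp: hclass_eq_iff)

lemma elem_homotopy_hclass_eq:
  assumes "((x, p), (x, q)) \<in> elem_homotopy S M W"
  shows "hcl x p = hcl x q"
  using assms elem_homotopy_ends[of x p x q] by (subst hclass_eq_iff) (auto simp: homotopy_def)

lemma hclass_context:
  assumes "hcl y p = hcl y q" "path y p" "path y q"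
    and "path x u" "gal_term W (x, u) = y" "path (gal_term W (y, p)) v"
  shows "hcl x (u @ p @ v) = hcl x (u @ q @ v)"
proof -
  have "((y, p), (y, q)) \<in> homotopy S M W"
    using assms by (simp add: hclass_eq_iff)
  then show ?thesis
    using assms homotopic_context[of y p "(y, q)" x u v] by (simp add: hclass_eq_iff homotopy_def)
qed

lemma hclass_append_cong:
  assumes "hcl x p = hcl x p'" "hcl y q = hcl y q'"
    and "path x p" "path x p'" "path y q" "path y q'" "y = gal_term W (x, p)"
  shows "hcl x (p @ q) = hcl x (p' @ q')"
proof -
  have "hcl x (p @ q) = hcl x (p' @ q)"
    using assms hclass_context[of x p p' x "[]" q] is_path_start[of x p] by simp
  also have "\<dots> = hcl x (p' @ q')"
    using assms hclass_context[of y q q' x p' "[]"] hclass_eqD[of x p x p'] is_path_end[of y q] by simp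
  finally show ?thesis .
qed

lemma hclass_backtrack:
  assumes "i \<in> edges S W"
  shows "hcl (esrc W i) [i, einv W i] = hcl (esrc W i) []"
  using elem_homotopy.backtrack[where x = "esrc W i" and u = "[]" and i = i and v = "[]"] assms
  by (intro elem_homotopy_hclass_eq) (simp add: einv_props esrc_in)

lemma hclass_suite:
  assumes "(x, p) \<in> defining_suites S M W"
  shows "hcl x p = hcl x []"
  using elem_homotopy.suite[where x = x and u = "[]" and \<delta> = "(x, p)" and v = "[]"] assms
    defining_suite_closed[OF assms] is_path_start[of x p]
  by (intro elem_homotopy_hclass_eq) simp

text \<open>Sending identities to the empty path makes every arrow of a panel groupoid a path. A
  composition with an identity factor, a cancellation and a merge then obey a single law,
  \<open>hclass_seg_comp\<close>.\<close>

definition seg :: "'s \<Rightarrow> 'e \<Rightarrow> ('s \<times> 'e) list" where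
  "seg s e = (if e \<in> gids (panels W s) then [] else [(s, e)])"

lemma seg_path:
  assumes "s \<in> S" "e \<in> garcs (panels W s)"
  shows "path (gsrc (panels W s) e) (seg s e)"
    and "gal_term W (gsrc (panels W s) e, seg s e) = gtrg (panels W s) e"
proof -
  interpret P: grpd "panels W s" using panel_grpd assms by blast
  show "path (gsrc (panels W s) e) (seg s e)"
    "gal_term W (gsrc (panels W s) e, seg s e) = gtrg (panels W s) e"
    using assms P.src_in P.trg_in panel_verts
    by (auto simp: seg_def edges_iff esrc_def etrg_def P.src_eq_trg_gids)
qed

text \<open>Up to homotopy, the backtrack and merge moves together realise the multiplication of a
  panel groupoid.\<close>

lemma hclass_seg_comp:
  assumes "s \<in> S" "e \<in> garcs (panels W s)" "e' \<in> garcs (panels W s)"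
    and "gtrg (panels W s) e = gsrc (panels W s) e'"
  shows "hcl (gsrc (panels W s) e) (seg s e @ seg s e') =
    hcl (gsrc (panels W s) e) (seg s (gcomp (panels W s) e e'))"
proof -
  interpret P: grpd "panels W s" using panel_grpd assms by blast
  consider "e \<in> gids (panels W s) \<or> e' \<in> gids (panels W s)"
    | "e \<notin> gids (panels W s)" "e' = ginv (panels W s) e"
    | "e \<notin> gids (panels W s)" "e' \<notin> gids (panels W s)" "e' \<noteq> ginv (panels W s) e"
    by blast
  then show ?thesis
  proof cases
    case 1
    then show ?thesis
      using assms P.gids_comp[of e e'] P.comp_gids[of e e'] by (auto simp: seg_def)
  next
    case 2
    then show ?thesis
      using assms hclass_backtrack[of "(s, e)"] P.comp_in_gids_iff[of e e'] P.inv_in_gids_iff[of e]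
      by (simp add: seg_def edges_iff esrc_def einv_def)
  next
    case 3
    then have "gcomp (panels W s) e e' \<notin> gids (panels W s)"
      using assms P.comp_in_gids_iff by blast
    then show ?thesis
      using 3 assms P.trg_in[of e'] panel_verts
        elem_homotopy.merge[where x = "gsrc (panels W s) e" and u = "[]" and s = s and i = e and i' = e' and v = "[]"]
      by (simp add: elem_homotopy_hclass_eq seg_def edges_iff esrc_def etrg_def)
  qed
qed

section \<open>Reversal of paths and the fundamental groupoid\<close>

definition rpath :: "('s \<times> 'e) list \<Rightarrow> ('s \<times> 'e) list" where
  "rpath p = rev (map (einv W) p)"

lemma rpath_simps [simp]: "rpath [] = []" "rpath (i # p) = rpath p @ [einv W i]"
  by (simp_all add: rpath_def)

lemma path_rpath:
  assumes "path x p"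
  shows "path (gal_term W (x, p)) (rpath p)" "gal_term W (gal_term W (x, p), rpath p) = x"
  using assms by (induction p arbitrary: x) (auto simp: einv_props esrc_in)

lemma rpath_rpath: "path x p \<Longrightarrow> rpath (rpath p) = p"
  using is_path_edges[of x p] by (auto simp: rpath_def rev_map[symmetric] einv_einv intro!: map_idI)

lemma hclass_append_rpath: "path x p \<Longrightarrow> hcl x (p @ rpath p) = hcl x []"
proof (induction p arbitrary: x)
  case (Cons i p)
  then have i: "i \<in> edges S W" "esrc W i = x" "path (etrg W i) p"
    by auto
  \<comment> \<open>The inner path \<open>p @ rpath p\<close> contracts first, by induction, and
    exposes the backtrack \<open>[i, einv W i]\<close>.\<close>
  have "hcl x ((i # p) @ rpath (i # p)) = hcl x ([i] @ (p @ rpath p) @ [einv W i])"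
    by simp
  also have "\<dots> = hcl x ([i] @ [] @ [einv W i])"
    using i Cons.IH[of "etrg W i"] path_rpath[of "etrg W i" p]
    by (intro hclass_context[of "etrg W i"]) (auto simp: etrg_in einv_props esrc_in)
  also have "\<dots> = hcl x []"
    using hclass_backtrack[OF i(1)] i(2) by simp
  finally show ?case .
qed simp

lemma hclass_rpath_append:
  assumes "path x p"
  shows "hcl (gal_term W (x, p)) (rpath p @ p) = hcl (gal_term W (x, p)) []"
  using hclass_append_rpath[OF path_rpath(1)[OF assms]] rpath_rpath[OF assms] by simp

lemma FG_simps:
  shows FG_verts: "gverts FG = chambers W"
    and FG_arcs: "garcs FG = {hcl x p | x p. path x p}"
    and FG_src: "path x p \<Longrightarrow> gsrc FG (hcl x p) = x"
    and FG_trg: "path x p \<Longrightarrow> gtrg FG (hcl x p) = gal_term W (x, p)"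
    and FG_id: "gid FG x = hcl x []"
proof -
  show "gverts FG = chambers W" "gid FG x = hcl x []"
    by (simp_all add: fundamental_groupoid_def)
  show "garcs FG = {hcl x p | x p. path x p}"
    by (auto simp: fundamental_groupoid_def quotient_def hclass_def galleries_def)
  assume "path x p"
  \<comment> \<open>The class contains \<open>(x, p)\<close>, so the representative picked by
    \<open>SOME\<close> is homotopic to it and has the same ends.\<close>
  then have "((x, p), (x, p)) \<in> homotopy S M W"
    by (simp add: homotopy_def)
  then have "(x, p) \<in> hcl x p"
    by (simp add: hclass_def)
  then have "(SOME b. b \<in> hcl x p) \<in> hcl x p"
    by (rule someI)
  moreover obtain y q where "(SOME b. b \<in> hcl x p) = (y, q)"
    by fastforce
  ultimately show "gsrc FG (hcl x p) = x" "gtrg FG (hcl x p) = gal_term W (x, p)"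
    using homotopy_ends[of x p y q]
    by (simp_all add: fundamental_groupoid_def hclass_def gal_init_def)
qed

text \<open>All pairs of representatives give the same class, and there is at least one pair, so the
  union in \<open>gcomp\<close> is that class.\<close>

lemma FG_comp:
  assumes "path x p" "path (gal_term W (x, p)) q"
  shows "gcomp FG (hcl x p) (hcl (gal_term W (x, p)) q) = hcl x (p @ q)"
proof -
  let ?y = "gal_term W (x, p)"
  have self: "(x, p) \<in> hcl x p" "(?y, q) \<in> hcl ?y q"
    using assms by (auto simp: hclass_def homotopy_def)
  have eq: "hclass S M W (gal_append b c) = hcl x (p @ q)" if "b \<in> hcl x p" "c \<in> hcl ?y q" for b c
  proof -
    have "((x, p), b) \<in> homotopy S M W" "((?y, q), c) \<in> homotopy S M W"
      using that by (simp_all add: hclass_def)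
    moreover obtain p' q' where "b = (x, p')" "c = (?y, q')"
      using calculation homotopy_ends by (cases b; cases c) blast
    moreover have "path x p'" "path ?y q'"
      using calculation by (auto simp: homotopy_def)
    ultimately show ?thesis
      using hclass_append_cong[of x p p' ?y q q'] assms by (simp add: gal_append_def hclass_eq_iff)
  qed
  have "gcomp FG (hcl x p) (hcl ?y q) = (\<Union>b\<in>hcl x p. \<Union>c\<in>hcl ?y q. hclass S M W (gal_append b c))"
    by (simp add: fundamental_groupoid_def)
  also have "\<dots> = hcl x (p @ q)"
    using self by (auto simp: eq)
  finally show ?thesis .
qed

text \<open>The start of the second path is a variable of its own, so that rewriting applies
  whatever the syntactic form of that chamber.\<close>

lemma FG_comp':
  "\<lbrakk>path x p; path y q; y = gal_term W (x, p)\<rbrakk> \<Longrightarrow> gcomp FG (hcl x p) (hcl y q) = hcl x (p @ q)"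
  using FG_comp by simp

lemma FG_groupoid: "grpd FG"
proof
  have inv: "\<exists>h\<in>garcs FG. gsrc FG h = gtrg FG (hcl x p) \<and> gtrg FG h = gsrc FG (hcl x p) \<and>
      gcomp FG (hcl x p) h = gid FG (gsrc FG (hcl x p)) \<and>
      gcomp FG h (hcl x p) = gid FG (gtrg FG (hcl x p))" if "path x p" for x p
    using that path_rpath[OF that]
    by (intro bexI[of _ "hcl (gal_term W (x, p)) (rpath p)"])
      (auto simp: FG_simps FG_comp' hclass_append_rpath hclass_rpath_append)
  show "is_groupoid FG"
    unfolding is_groupoid_def
  proof (intro conjI ballI impI)
    show "gverts FG \<noteq> {}"
      using chamber_system by (simp add: FG_verts chamber_system_def)
  next
    fix g assume "g \<in> garcs FG"
    then obtain x p where "g = hcl x p" "path x p"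
      by (auto simp: FG_arcs)
    then show "gsrc FG g \<in> gverts FG" "gtrg FG g \<in> gverts FG"
      "gcomp FG (gid FG (gsrc FG g)) g = g" "gcomp FG g (gid FG (gtrg FG g)) = g"
      "\<exists>h\<in>garcs FG. gsrc FG h = gtrg FG g \<and> gtrg FG h = gsrc FG g \<and>
        gcomp FG g h = gid FG (gsrc FG g) \<and> gcomp FG h g = gid FG (gtrg FG g)"
      using inv is_path_start[of x p] is_path_end[of x p] by (simp_all add: FG_simps FG_comp')
  next
    fix x assume "x \<in> gverts FG"
    then show "gid FG x \<in> garcs FG" "gsrc FG (gid FG x) = x" "gtrg FG (gid FG x) = x"
      by (auto simp: FG_simps intro!: exI[of _ x] exI[of _ "[]"])
  next
    fix g h assume "g \<in> garcs FG" "h \<in> garcs FG" "gtrg FG g = gsrc FG h"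
    then obtain x p q where "g = hcl x p" "path x p" "h = hcl (gal_term W (x, p)) q"
      "path (gal_term W (x, p)) q"
      by (auto simp: FG_simps)
    then show "gcomp FG g h \<in> garcs FG" "gsrc FG (gcomp FG g h) = gsrc FG g"
      "gtrg FG (gcomp FG g h) = gtrg FG h"
      by (auto simp: FG_simps FG_comp' intro!: exI[of _ x] exI[of _ "p @ q"])
  next
    fix g h k assume "g \<in> garcs FG" "h \<in> garcs FG" "k \<in> garcs FG"
      "gtrg FG g = gsrc FG h \<and> gtrg FG h = gsrc FG k"
    then obtain x p q r where "g = hcl x p" "path x p" "h = hcl (gal_term W (x, p)) q"
      "path (gal_term W (x, p)) q" "k = hcl (gal_term W (x, p @ q)) r"
      "path (gal_term W (x, p @ q)) r"
      by (auto simp: FG_simps)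
    then show "gcomp FG (gcomp FG g h) k = gcomp FG g (gcomp FG h k)"
      by (simp add: FG_simps FG_comp')
  qed
qed

lemma FG_inv:
  assumes "path x p"
  shows "ginv FG (hcl x p) = hcl (gal_term W (x, p)) (rpath p)"
  using assms path_rpath[OF assms]
  by (intro grpd.ginv_eqI[OF FG_groupoid])
    (auto simp: FG_simps FG_comp' hclass_append_rpath)

lemma carrier_local_group_FG:
  "carrier (local_group FG x) = {hcl x p | p. path x p \<and> gal_term W (x, p) = x}"
  by (force simp: local_group_def FG_simps)

end

section \<open>Generators and expressions\<close>

locale gen_setup = weyl_setup S M W
  for S :: "'s set" and M :: "'s \<Rightarrow> 's \<Rightarrow> enat" and W :: "('s, 'c, 'e) weyl_data" +
  fixes D :: "('s, 'c, 'e) gen_data"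
  assumes gen_data: "is_gen_data S W D"
begin

lemma base_in: "\<lbrakk>s \<in> S; b \<in> base D s\<rbrakk> \<Longrightarrow> b \<in> chambers W"
  using gen_data by (auto simp: is_gen_data_def)

lemma star_props:
  assumes "s \<in> S" "C \<in> chambers W" "C \<notin> base D s"
  shows star_arc: "star D s C \<in> garcs (panels W s)"
    and src_star: "gsrc (panels W s) (star D s C) \<in> base D s"
    and trg_star: "gtrg (panels W s) (star D s C) = C"
  using gen_data assms by (auto simp: is_gen_data_def)

text \<open>Both ends of \<open>e\<close> lie in the panel of its source, and a panel has exactly
  one base chamber.\<close>

lemma base_unique:
  assumes "s \<in> S" "e \<in> garcs (panels W s)"
    and "gsrc (panels W s) e \<in> base D s" "gtrg (panels W s) e \<in> base D s"
  shows "gtrg (panels W s) e = gsrc (panels W s) e"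
proof -
  interpret P: grpd "panels W s" using panel_grpd assms by blast
  define P where "P = panels W s \<lparr>gverts := component_verts (panels W s) (gsrc (panels W s) e),
    garcs := {g \<in> garcs (panels W s).
      gsrc (panels W s) g \<in> component_verts (panels W s) (gsrc (panels W s) e)}\<rparr>"
  have "P \<in> components (panels W s)"
    using P.src_in assms by (auto simp: components_def P_def)
  then have "\<exists>!b. b \<in> base D s \<and> b \<in> gverts P"
    using gen_data assms by (simp add: is_gen_data_def)
  moreover have "gsrc (panels W s) e \<in> gverts P"
    using assms P.src_in[of e]
    by (auto simp: P_def component_verts_def P.id_arc P.src_id P.trg_id
        intro!: bexI[of _ "gid (panels W s) (gsrc (panels W s) e)"])
  moreover have "gtrg (panels W s) e \<in> gverts P"
    using assms by (auto simp: P_def component_verts_def)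
  ultimately show ?thesis using assms by blast
qed

lemma star_pos_props:
  assumes "s \<in> S" "e \<in> star_pos W D s"
  shows "e \<in> garcs (panels W s)" "e \<notin> gids (panels W s)"
    "gsrc (panels W s) e \<in> base D s" "gtrg (panels W s) e \<notin> base D s"
    "star D s (gtrg (panels W s) e) = e"
proof -
  interpret P: grpd "panels W s" using panel_grpd assms by blast
  show "e \<in> garcs (panels W s)" "gsrc (panels W s) e \<in> base D s" "gtrg (panels W s) e \<notin> base D s"
    "star D s (gtrg (panels W s) e) = e"
    using assms star_props by (auto simp: star_pos_def)
  \<comment> \<open>A star edge leads from a base chamber to a chamber that is not one, whereas an
    identity ends where it starts.\<close>
  then show "e \<notin> gids (panels W s)"
    using P.src_eq_trg_gids by metis
qed

lemma gens_pos_edge: "i \<in> gens_pos S W D \<Longrightarrow> i \<in> edges S W"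
  using star_pos_props by (auto simp: gens_pos_def edges_iff)

lemma gens_neg_iff: "i \<in> gens_neg S W D \<longleftrightarrow> (\<exists>j\<in>gens_pos S W D. i = einv W j)"
  by (force simp: gens_neg_def gens_pos_def star_neg_def einv_def)

lemma generating_set_edge: "i \<in> generating_set S W D \<Longrightarrow> i \<in> edges S W"
proof -
  have "j \<in> edges S W" if "j \<in> gens_loops S W D" for j
    using that by (auto simp: gens_loops_def base_loops_def edges_iff)
  then show "i \<in> generating_set S W D \<Longrightarrow> i \<in> edges S W"
    unfolding generating_set_def Un_iff gens_neg_iff using gens_pos_edge einv_edge by blast
qed

lemma einv_gens:
  "i \<in> gens_pos S W D \<union> gens_neg S W D \<Longrightarrow> einv W i \<in> gens_pos S W D \<union> gens_neg S W D"
  using einv_einv gens_pos_edge by (auto simp: gens_neg_iff)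

section \<open>Factorization of an edge through the base chamber of its panel\<close>

definition root :: "'s \<Rightarrow> 'c \<Rightarrow> 'e" where
  "root s C = (if C \<in> base D s then gid (panels W s) C else star D s C)"

text \<open>This is the middle factor of an edge: the arrow is carried along the roots of its two
  ends to the local group at the base chamber. As a map on arrows it is multiplicative
  (\<open>loop_comp\<close>).\<close>

definition loop :: "'s \<Rightarrow> 'e \<Rightarrow> 'e" where
  "loop s e = (let G = panels W s in
    gcomp G (gcomp G (root s (gsrc G e)) e) (ginv G (root s (gtrg G e))))"

lemma root_props:
  assumes "s \<in> S" "C \<in> chambers W"
  shows root_arc: "root s C \<in> garcs (panels W s)"
    and src_root: "gsrc (panels W s) (root s C) \<in> base D s"
    and trg_root: "gtrg (panels W s) (root s C) = C"
    and root_in: "root s C \<in> star_pos W D s \<union> gids (panels W s)"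
    and inv_root_in: "ginv (panels W s) (root s C) \<in> star_neg W D s \<union> gids (panels W s)"
proof -
  interpret P: grpd "panels W s" using panel_grpd assms by blast
  show "root s C \<in> garcs (panels W s)" "gsrc (panels W s) (root s C) \<in> base D s"
    "gtrg (panels W s) (root s C) = C" and pos: "root s C \<in> star_pos W D s \<union> gids (panels W s)"
    using assms star_props P.id_arc P.src_id P.trg_id panel_verts
    by (auto simp: root_def star_pos_def gids_def)
  then show "ginv (panels W s) (root s C) \<in> star_neg W D s \<union> gids (panels W s)"
    using P.inv_in_gids_iff by (auto simp: star_neg_def)
qed

lemma base_loopsI:
  assumes "s \<in> S" "e \<in> garcs (panels W s)"
    and "gsrc (panels W s) e \<in> base D s" "gtrg (panels W s) e \<in> base D s"
  shows "e \<in> base_loops W D s \<union> gids (panels W s)"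
  using assms base_unique[OF assms] by (auto simp: base_loops_def)

lemma loop_props:
  assumes "s \<in> S" "e \<in> garcs (panels W s)"
  shows loop_arc: "loop s e \<in> garcs (panels W s)"
    and src_loop: "gsrc (panels W s) (loop s e) = gsrc (panels W s) (root s (gsrc (panels W s) e))"
    and trg_loop: "gtrg (panels W s) (loop s e) = gsrc (panels W s) (root s (gtrg (panels W s) e))"
    and loop_ends: "gtrg (panels W s) (loop s e) = gsrc (panels W s) (loop s e)"
    and src_loop_base: "gsrc (panels W s) (loop s e) \<in> base D s"
    and loop_in: "loop s e \<in> base_loops W D s \<union> gids (panels W s)"
proof -
  interpret P: grpd "panels W s" using panel_grpd assms by blast
  have C: "gsrc (panels W s) e \<in> chambers W" "gtrg (panels W s) e \<in> chambers W"
    using P.src_in P.trg_in panel_verts assms by auto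
  note root = root_props[OF assms(1) C(1)] root_props[OF assms(1) C(2)]
  show arc: "loop s e \<in> garcs (panels W s)"
    and src: "gsrc (panels W s) (loop s e) = gsrc (panels W s) (root s (gsrc (panels W s) e))"
    and trg: "gtrg (panels W s) (loop s e) = gsrc (panels W s) (root s (gtrg (panels W s) e))"
    using root assms
    by (simp_all add: loop_def Let_def P.comp_arc P.src_comp P.trg_comp P.ginv_props)
  show "gtrg (panels W s) (loop s e) = gsrc (panels W s) (loop s e)"
    "gsrc (panels W s) (loop s e) \<in> base D s"
    "loop s e \<in> base_loops W D s \<union> gids (panels W s)"
    using base_unique[OF assms(1) arc] base_loopsI[OF assms(1) arc] root src trg by simp_all
qed

text \<open>An outer factor that is not an identity is the star edge, or its inverse, prescribed by
  the matching end of \<open>e\<close>. If an outer factor is an identity, some other factor is not,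
  because \<open>e\<close> is not; the ends of that factor place the identity at a base chamber,
  where the root is an identity too. For an identity \<open>e\<close> away from the base chambers
  uniqueness fails: three identities would compete with the root and its inverse.\<close>

lemma factors_unique:
  assumes "s \<in> S" "e \<notin> gids (panels W s)"
    and a: "a \<in> star_neg W D s \<union> gids (panels W s)"
    and b: "b \<in> base_loops W D s \<union> gids (panels W s)"
    and c: "c \<in> star_pos W D s \<union> gids (panels W s)"
    and ends: "gtrg (panels W s) a = gsrc (panels W s) b" "gtrg (panels W s) b = gsrc (panels W s) c"
    and e: "gcomp (panels W s) (gcomp (panels W s) a b) c = e"
  shows "a = ginv (panels W s) (root s (gsrc (panels W s) e))" "b = loop s e"
    "c = root s (gtrg (panels W s) e)"
proof -
  interpret P: grpd "panels W s" using panel_grpd assms by blast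
  have arcs: "a \<in> garcs (panels W s)" "b \<in> garcs (panels W s)" "c \<in> garcs (panels W s)"
    using a b c P.gids_arc star_pos_props[OF assms(1)] P.inv_arc
    by (auto simp: star_neg_def base_loops_def)
  have e_src: "gsrc (panels W s) e = gsrc (panels W s) a"
    and e_trg: "gtrg (panels W s) e = gtrg (panels W s) c"
    using arcs ends unfolding e[symmetric] by (simp_all add: P.comp_arc P.src_comp P.trg_comp)
  have not_all_ids: "a \<in> gids (panels W s) \<Longrightarrow> b \<in> gids (panels W s) \<Longrightarrow> c \<notin> gids (panels W s)"
    using assms(2) e ends arcs P.gids_comp by auto
  have id: "root s (gsrc (panels W s) f) = f"
    if "f \<in> gids (panels W s)" "gsrc (panels W s) f \<in> base D s" for f
    using that by (auto simp: root_def gids_def P.src_id)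
  show a_eq: "a = ginv (panels W s) (root s (gsrc (panels W s) e))"
  proof (cases "a \<in> gids (panels W s)")
    case True
    then have "gsrc (panels W s) a \<in> base D s"
      using b c ends not_all_ids star_pos_props(3)[OF assms(1)] P.src_eq_trg_gids
      by (auto simp: base_loops_def)
    then show ?thesis
      using True id[of a] e_src by (auto simp: gids_def P.inv_id)
  next
    case False
    then obtain f where "a = ginv (panels W s) f" "f \<in> star_pos W D s"
      using a by (auto simp: star_neg_def)
    then show ?thesis
      using star_pos_props[OF assms(1), of f] e_src by (simp add: root_def P.ginv_props)
  qed
  show c_eq: "c = root s (gtrg (panels W s) e)"
  proof (cases "c \<in> gids (panels W s)")
    case True
    have "gtrg (panels W s) a \<in> base D s" if "a \<in> star_neg W D s"
      using that star_pos_props(1,3)[OF assms(1)] by (auto simp: star_neg_def P.trg_inv)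
    then have "gtrg (panels W s) b \<in> base D s"
      using a b ends not_all_ids True P.src_eq_trg_gids by (auto simp: base_loops_def)
    then show ?thesis
      using True id[of c] e_trg ends P.src_eq_trg_gids by simp
  next
    case False
    then show ?thesis
      using c star_pos_props[OF assms(1), of c] e_trg by (simp add: root_def)
  qed
  have "root s (gsrc (panels W s) e) = ginv (panels W s) a"
    using P.inv_inv[OF root_arc[OF assms(1)]] P.src_in[OF arcs(1)] e_src panel_verts[OF assms(1)]
    by (subst a_eq) simp
  then have "loop s e = gcomp (panels W s) (gcomp (panels W s) (ginv (panels W s) a)
      (gcomp (panels W s) (gcomp (panels W s) a b) c)) (ginv (panels W s) c)"
    by (simp add: loop_def Let_def e c_eq[symmetric])
  \<comment> \<open>Two passes: associating to the right cancels \<open>a\<close> against its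
    inverse, then associating to the left cancels \<open>c\<close>.\<close>
  also have "\<dots> = b"
    using arcs ends
    by (simp add: P.comp_assoc P.comp_arc P.ginv_props P.src_comp P.trg_comp P.inv_comp_cancel_left)
      (simp add: P.comp_assoc[symmetric] P.comp_arc P.ginv_props P.src_comp P.trg_comp P.comp_inv P.comp_id ends(2)[symmetric])
  finally show "b = loop s e" ..
qed

lemma edge_expr_eqI:
  assumes "(s, e) \<in> edges S W"
    and "a \<in> star_neg W D s \<union> gids (panels W s)"
    and "b \<in> base_loops W D s \<union> gids (panels W s)"
    and "c \<in> star_pos W D s \<union> gids (panels W s)"
    and "gtrg (panels W s) a = gsrc (panels W s) b" "gtrg (panels W s) b = gsrc (panels W s) c"
    and "gcomp (panels W s) (gcomp (panels W s) a b) c = e"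
  shows "edge_expr W D (s, e) = seg s a @ seg s b @ seg s c"
proof -
  have e: "s \<in> S" "e \<notin> gids (panels W s)"
    using assms(1) by (auto simp: edges_iff)
  have "factors W D (s, e) = (a, b, c)"
    unfolding factors_def Let_def fst_conv snd_conv
  proof (rule the_equality)
    fix t assume t: "case t of (a, b, c) \<Rightarrow> a \<in> star_neg W D s \<union> gids (panels W s) \<and>
      b \<in> base_loops W D s \<union> gids (panels W s) \<and> c \<in> star_pos W D s \<union> gids (panels W s) \<and>
      gtrg (panels W s) a = gsrc (panels W s) b \<and> gtrg (panels W s) b = gsrc (panels W s) c \<and>
      gcomp (panels W s) (gcomp (panels W s) a b) c = e"
    obtain a' b' c' where "t = (a', b', c')" by (cases t)
    then show "t = (a, b, c)"
      using t factors_unique[OF e assms(2-)] factors_unique[OF e, of a' b' c'] by simp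
  qed (use assms in simp)
  then show ?thesis
    by (simp add: edge_expr_def seg_def)
qed

text \<open>This is the existence half of the factorization: the roots built into
  \<open>loop\<close> cancel. It covers identity arrows as well.\<close>

lemma root_loop_root:
  assumes "s \<in> S" "e \<in> garcs (panels W s)"
  shows "gcomp (panels W s) (gcomp (panels W s) (ginv (panels W s) (root s (gsrc (panels W s) e)))
      (loop s e)) (root s (gtrg (panels W s) e)) = e"
proof -
  interpret P: grpd "panels W s" using panel_grpd assms by blast
  have C: "gsrc (panels W s) e \<in> chambers W" "gtrg (panels W s) e \<in> chambers W"
    using P.src_in P.trg_in panel_verts assms by auto
  show ?thesis
    using root_props[OF assms(1) C(1)] root_props[OF assms(1) C(2)] assms
    by (simp add: loop_def Let_def P.comp_assoc P.comp_arc P.ginv_props P.src_comp P.trg_comp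
        P.inv_comp_cancel_left P.inv_comp P.comp_id)
qed

lemma edge_expr_root:
  assumes "(s, e) \<in> edges S W"
  shows "edge_expr W D (s, e) =
    seg s (ginv (panels W s) (root s (gsrc (panels W s) e))) @ seg s (loop s e) @
    seg s (root s (gtrg (panels W s) e))"
proof -
  have e: "s \<in> S" "e \<in> garcs (panels W s)"
    using assms by (auto simp: edges_iff)
  interpret P: grpd "panels W s" using panel_grpd e by blast
  have C: "gsrc (panels W s) e \<in> chambers W" "gtrg (panels W s) e \<in> chambers W"
    using P.src_in P.trg_in panel_verts e by auto
  show ?thesis
    using assms root_props[OF e(1) C(1)] root_props[OF e(1) C(2)] loop_props[OF e] root_loop_root[OF e]
    by (intro edge_expr_eqI) (auto simp: P.ginv_props)
qed

text \<open>A generator is a factorization of itself with two identity factors, and factors are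
  unique. This is what recovers single letters in \<open>cls_wd_word_path\<close>.\<close>

lemma edge_expr_generator:
  assumes "i \<in> generating_set S W D"
  shows "edge_expr W D i = [i]"
proof -
  obtain s e where i: "i = (s, e)" by fastforce
  have edge: "(s, e) \<in> edges S W"
    using assms generating_set_edge i by blast
  then have e: "s \<in> S" "e \<in> garcs (panels W s)" "e \<notin> gids (panels W s)"
    by (auto simp: edges_iff)
  interpret P: grpd "panels W s" using panel_grpd e by blast
  let ?id = "gid (panels W s)"
  have ids: "?id (gsrc (panels W s) e) \<in> gids (panels W s)" "?id (gtrg (panels W s) e) \<in> gids (panels W s)"
    using e P.src_in P.trg_in by (auto simp: gids_def)
  note simps = seg_def P.src_in P.trg_in P.src_id P.trg_id P.id_comp P.comp_id P.id_arc
  have "e \<in> star_neg W D s \<or> e \<in> base_loops W D s \<or> e \<in> star_pos W D s"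
    using assms i by (auto simp: generating_set_def gens_loops_def gens_pos_def gens_neg_def)
  then show ?thesis
  proof (elim disjE)
    assume "e \<in> star_neg W D s"
    then show ?thesis
      using edge_expr_eqI[OF edge, of e "?id (gtrg (panels W s) e)" "?id (gtrg (panels W s) e)"] e ids i
      by (simp add: simps)
  next
    assume "e \<in> base_loops W D s"
    then show ?thesis
      using edge_expr_eqI[OF edge, of "?id (gsrc (panels W s) e)" e "?id (gtrg (panels W s) e)"] e ids i
      by (simp add: simps)
  next
    assume "e \<in> star_pos W D s"
    then show ?thesis
      using edge_expr_eqI[OF edge, of "?id (gsrc (panels W s) e)" "?id (gsrc (panels W s) e)" e] e ids i
        P.id_comp[of "?id (gsrc (panels W s) e)"]
      by (simp add: simps)
  qed
qed

lemma seg_generators: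
  assumes "s \<in> S" "e \<in> star_neg W D s \<union> base_loops W D s \<union> star_pos W D s \<union> gids (panels W s)"
  shows "set (seg s e) \<subseteq> generating_set S W D"
  using assms
  by (auto simp: seg_def generating_set_def gens_loops_def gens_pos_def gens_neg_def)

lemma edge_expr_generators:
  assumes "i \<in> edges S W"
  shows "set (edge_expr W D i) \<subseteq> generating_set S W D"
proof -
  obtain s e where i: "i = (s, e)" by fastforce
  have e: "s \<in> S" "e \<in> garcs (panels W s)"
    using assms i by (auto simp: edges_iff)
  then have C: "gsrc (panels W s) e \<in> chambers W" "gtrg (panels W s) e \<in> chambers W"
    using grpd.src_in[OF panel_grpd] grpd.trg_in[OF panel_grpd] panel_verts by auto
  show ?thesis
    using assms i seg_generators[OF e(1)] inv_root_in[OF e(1) C(1)] loop_in[OF e] root_in[OF e(1) C(2)]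
    by (auto simp: edge_expr_root)
qed

end

section \<open>Spanning trees\<close>

locale tree_setup = gen_setup S M W D
  for S :: "'s set" and M :: "'s \<Rightarrow> 's \<Rightarrow> enat" and W :: "('s, 'c, 'e) weyl_data"
    and D :: "('s, 'c, 'e) gen_data" +
  fixes T :: "('s \<times> 'e) set"
  assumes spanning_tree: "weyl_spanning_tree S W D T"
begin

abbreviation und :: "'s \<times> 'e \<Rightarrow> ('s \<times> 'e) set" where
  "und i \<equiv> {i, einv W i}"

abbreviation tree_graph :: "('c, ('s \<times> 'e) set) multigraph" where
  "tree_graph \<equiv> star_graph S W D\<lparr>mg_edges := und ` T\<rparr>"

lemma tree_props:
  shows tree_gens: "i \<in> T \<Longrightarrow> i \<in> gens_pos S W D \<union> gens_neg S W D"
    and einv_tree: "i \<in> T \<Longrightarrow> einv W i \<in> T"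
    and tree_graph: "mg_tree tree_graph"
proof -
  obtain F where F: "F \<subseteq> {und i | i. i \<in> gens_pos S W D}"
    "mg_tree (star_graph S W D\<lparr>mg_edges := F\<rparr>)"
    "T = {i \<in> gens_pos S W D \<union> gens_neg S W D. \<exists>a\<in>F. i \<in> a}"
    using spanning_tree
    unfolding weyl_spanning_tree_def mg_spanning_tree_def star_graph_def multigraph.simps by blast
  show gens: "i \<in> gens_pos S W D \<union> gens_neg S W D" if "i \<in> T" for i
    using that F(3) by blast
  have in_F: "und i \<in> F" if i: "i \<in> T" for i
  proof -
    obtain a where a: "a \<in> F" "i \<in> a" using i F(3) by blast
    then obtain j where j: "j \<in> gens_pos S W D" "a = und j"
      using F(1) by blast
    \<comment> \<open>Either orientation of an edge names the same undirected edge, by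
      \<open>einv_einv\<close>.\<close>
    have "und i = und j"
      using a(2) einv_einv[OF gens_pos_edge[OF j(1)]] unfolding j(2) by auto
    then show ?thesis using a(1) j(2) by simp
  qed
  have "a \<in> und ` T" if a: "a \<in> F" for a
  proof -
    obtain j where "j \<in> gens_pos S W D" "a = und j"
      using F(1) a by blast
    moreover from this have "j \<in> T" using a F(3) by blast
    ultimately show ?thesis by blast
  qed
  then have "F = und ` T" using in_F by auto
  then show "mg_tree tree_graph" using F(2) by simp
  show "einv W i \<in> T" if "i \<in> T"
    using einv_gens[OF gens[OF that]] in_F[OF that] F(3) by blast
qed

lemma tree_edge: "i \<in> T \<Longrightarrow> i \<in> edges S W"
  using tree_gens[of i] generating_set_edge[of i] by (simp add: generating_set_def)

lemma rpath_tree: "set p \<subseteq> T \<Longrightarrow> set (rpath p) \<subseteq> T"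
  using einv_tree by (auto simp: rpath_def)

lemma tree_path_ex:
  assumes "x \<in> chambers W" "y \<in> chambers W"
  obtains p where "path x p" "gal_term W (x, p) = y" "set p \<subseteq> T"
proof -
  have "\<exists>p. path x p \<and> gal_term W (x, p) = y \<and> set p \<subseteq> T"
    if "mg_walk tree_graph x as y" for as x
    using that
  proof (induction as arbitrary: x)
    case Nil
    then show ?case by (auto simp: star_graph_def intro!: exI[of _ "[]"])
  next
    case (Cons a as)
    then obtain z where "a \<in> und ` T" "esrc W ` a \<union> etrg W ` a = {x, z}"
      and z: "mg_walk tree_graph z as y"
      by (auto simp: star_graph_def)
    moreover obtain i where "i \<in> T" "a = {i, einv W i}"
      using calculation by blast
    ultimately have i: "i \<in> T" "a = {i, einv W i}" "esrc W ` a \<union> etrg W ` a = {x, z}"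
      by auto
    have "{esrc W i, etrg W i} = {x, z}"
      using i tree_edge[of i] by (auto simp: einv_props)
    then have "esrc W i = x \<and> etrg W i = z \<or> esrc W i = z \<and> etrg W i = x"
      by (auto simp: doubleton_eq_iff)
    \<comment> \<open>The walk forgets orientation; one of \<open>i\<close> and
      \<open>einv W i\<close> runs the right way, and \<open>T\<close> contains both.\<close>
    then have "\<exists>j\<in>T. esrc W j = x \<and> etrg W j = z"
      using i(1) tree_edge[OF i(1)] einv_tree[OF i(1)] esrc_einv[of i] etrg_einv[of i] by blast
    then obtain j where "j \<in> T" "esrc W j = x" "etrg W j = z"
      by blast
    moreover obtain p where "path z p \<and> gal_term W (z, p) = y \<and> set p \<subseteq> T"
      using Cons.IH z by blast
    ultimately show ?case
      using tree_edge by (intro exI[of _ "j # p"]) auto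
  qed
  moreover have "\<exists>as. mg_walk tree_graph x as y"
    using tree_graph assms by (simp add: mg_tree_def mg_connected_def star_graph_def)
  ultimately show ?thesis using that by blast
qed

lemma is_path_etrg_nth:
  "\<lbrakk>path x p; k < length p\<rbrakk> \<Longrightarrow>
    etrg W (p ! k) = (if Suc k < length p then esrc W (p ! Suc k) else gal_term W (x, p))"
proof (induction p arbitrary: x k)
  case (Cons i p)
  then show ?case
    by (cases k; cases p) auto
qed simp

text \<open>If the undirected edges were pairwise distinct, the path would be a cycle of the tree;
  loops and pairs of parallel edges count as cycles here. So one of them is used twice, and as the
  chambers are distinct, the two uses run in opposite directions and follow each other on both
  sides. Only a backtrack is left.\<close>

lemma tree_no_cycle:
  assumes "path x p" "gal_term W (x, p) = x" "set p \<subseteq> T" "p \<noteq> []" "distinct (map (esrc W) p)"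
  obtains i where "p = [i, einv W i]"
proof -
  define n where "n = length p"
  have T: "p ! k \<in> T" if "k < n" for k
    using assms(3) that by (auto simp: n_def)
  have first: "esrc W (p ! 0) = x"
    using assms(1,4) by (cases p) auto
  have next_vertex: "etrg W (p ! k) = esrc W (p ! (Suc k mod n))" if "k < n" for k
  proof (cases "Suc k < n")
    case True
    then show ?thesis using is_path_etrg_nth[OF assms(1), of k] by (simp add: n_def)
  next
    case False
    then have "Suc k = n" using that by simp
    then show ?thesis using is_path_etrg_nth[OF assms(1), of k] assms(2) first by (simp add: n_def)
  qed
  have inj: "k = l" if "esrc W (p ! k) = esrc W (p ! l)" "k < n" "l < n" for k l
    using that assms(5) nth_eq_iff_index_eq[of "map (esrc W) p" k l] by (simp add: n_def)
  define as where "as = map und p"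
  have "\<not> distinct as"
  proof
    assume "distinct as"
    moreover have "esrc W ` (as ! k) \<union> etrg W ` (as ! k) =
        {map (esrc W) p ! k, map (esrc W) p ! (Suc k mod length as)}" if "k < length as" for k
    proof -
      have k: "k < n" "Suc k mod n < n"
        using that by (auto simp: as_def n_def intro: mod_less_divisor)
      show ?thesis
        using T[OF k(1)] tree_edge[of "p ! k"] k next_vertex[OF k(1)]
        by (auto simp: as_def n_def einv_props)
    qed
    moreover have "set as \<subseteq> und ` T"
      using assms(3) by (auto simp: as_def)
    ultimately have "mg_cycle tree_graph (map (esrc W) p) as"
      using assms tree_edge esrc_in by (auto simp: mg_cycle_def star_graph_def as_def)
    then show False
      using tree_graph by (auto simp: mg_tree_def)
  qed
  then obtain k' l' where kl': "k' < n" "l' < n" "k' \<noteq> l'" "as ! k' = as ! l'"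
    by (auto simp: distinct_conv_nth as_def n_def)
  obtain k l where kl: "k < l" "l < n" "{p ! k, einv W (p ! k)} = {p ! l, einv W (p ! l)}"
    using kl' that[of k' l'] that[of l' k'] by (cases "k' < l'") (auto simp: as_def n_def)
  \<comment> \<open>With the same orientation the two edges would share their source, against
    \<open>inj\<close>.\<close>
  have inv: "p ! l = einv W (p ! k)"
    using kl inj[of k l] by (auto simp: doubleton_eq_iff)
  have e: "p ! k \<in> edges S W"
    using T[of k] kl tree_edge by simp
  have "esrc W (p ! l) = esrc W (p ! (Suc k mod n))" "esrc W (p ! (Suc l mod n)) = esrc W (p ! k)"
    using next_vertex[of k] next_vertex[of l] kl inv e by (simp_all add: einv_props)
  \<comment> \<open>Cyclically, \<open>l\<close> comes right after \<open>k\<close> and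
    \<open>k\<close> right after \<open>l\<close>; together with \<open>k < l\<close> this forces
    \<open>n = 2\<close>.\<close>
  then have "l = Suc k mod n" "Suc l mod n = k"
    using inj[of l "Suc k mod n"] inj[of "Suc l mod n" k] kl by auto
  then have "k = 0" "l = 1" "n = 2"
    using kl by (auto simp: mod_Suc split: if_splits)
  then have "p = [p ! 0, einv W (p ! 0)]"
    using inv by (intro nth_equalityI) (auto simp: n_def less_2_cases_iff)
  then show ?thesis using that by blast
qed

text \<open>Backtracks are removed one at a time: if prefixing \<open>i\<close> to a simple path
  makes it return to \<open>x\<close>, the closed initial piece is a backtrack by
  \<open>tree_no_cycle\<close> and can be deleted. The final chamber is listed among the distinct
  ones, so a closed path of this kind is empty; \<open>tree_closed_path\<close> rests on
  that.\<close>

lemma tree_path_simple: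
  assumes "path x p" "set p \<subseteq> T"
  shows "\<exists>q. path x q \<and> set q \<subseteq> T \<and> hcl x q = hcl x p \<and>
    distinct (map (esrc W) q @ [gal_term W (x, q)])"
  using assms
proof (induction p arbitrary: x)
  case Nil
  then show ?case by (intro exI[of _ "[]"]) simp
next
  case (Cons i p)
  then have i: "i \<in> T" "i \<in> edges S W" "esrc W i = x" "path (etrg W i) p" by auto
  obtain q where q: "path (etrg W i) q" "set q \<subseteq> T" "hcl (etrg W i) q = hcl (etrg W i) p"
    "distinct (map (esrc W) q @ [gal_term W (etrg W i, q)])"
    using Cons.IH[of "etrg W i"] Cons.prems by auto
  have iq: "hcl x (i # q) = hcl x (i # p)"
    using hclass_context[OF q(3) q(1) i(4), of x "[i]" "[]"] i q(1) is_path_end[OF q(1)]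
    by (simp add: etrg_in esrc_in)
  show ?case
  proof (cases "x \<in> set (map (esrc W) q @ [gal_term W (etrg W i, q)])")
    case False
    then show ?thesis
      using i q iq by (intro exI[of _ "i # q"]) auto
  next
    case True
    obtain r r' where r: "q = r @ r'" "gal_term W (etrg W i, r) = x"
    proof (cases "x \<in> set (map (esrc W) q)")
      case True
      then obtain j r r' where "q = r @ j # r'" "esrc W j = x"
        by (auto simp: in_set_conv_decomp)
      then show ?thesis using that[of r "j # r'"] q(1) by auto
    next
      case False
      then show ?thesis using that[of q "[]"] True by auto
    qed
    \<comment> \<open>The chambers of \<open>q\<close> are distinct, so \<open>x\<close> does not
      occur before the cut and \<open>i # r\<close> is a closed path with distinct sources.\<close>
    have "x \<notin> set (map (esrc W) r)"
      using q(4) r True q(1) by (cases r') auto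
    then have "distinct (map (esrc W) (i # r))"
      using q(4) r i by auto
    then obtain j where "i # r = [j, einv W j]"
      using tree_no_cycle[of x "i # r"] i q r by auto
    then have "r = [einv W i]" by simp
    then have "hcl x (i # q) = hcl x r'"
      using hclass_context[OF hclass_backtrack[OF i(2)], of "esrc W i" "[]" r'] i r q(1) is_path_start[of x r']
      by (simp add: einv_props esrc_in)
    then show ?thesis
      using q r i iq by (intro exI[of _ r']) auto
  qed
qed

lemma tree_closed_path:
  assumes "path x p" "set p \<subseteq> T" "gal_term W (x, p) = x"
  shows "hcl x p = hcl x []"
proof -
  obtain q where q: "path x q" "hcl x q = hcl x p" "distinct (map (esrc W) q @ [gal_term W (x, q)])"
    using tree_path_simple assms by blast
  then have "gal_term W (x, q) = x"
    using hclass_eqD[of x p x q] assms by simp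
  then have "q = []"
    using q by (cases q) auto
  then show ?thesis using q by simp
qed

end

section \<open>The group of a spanning tree\<close>

text \<open>Inverses in the presented group, at the level of words: the word is reversed and its
  signs are flipped, one letter at a time.\<close>

lemma ex_inverse_word:
  assumes "w \<in> gwords X"
  shows "\<exists>w'\<in>gwords X. pres_class X R (w @ w') = pres_class X R [] \<and>
    pres_class X R (w' @ w) = pres_class X R []"
  using assms
proof (induction w)
  case Nil
  then show ?case by (intro bexI[of _ "[]"]) auto
next
  case (Cons a w)
  obtain i b where a: "a = (i, b)" by fastforce
  then obtain w' where w': "w' \<in> gwords X" "pres_class X R (w @ w') = pres_class X R []"
    "pres_class X R (w' @ w) = pres_class X R []"
    using Cons by auto
  have X: "i \<in> X" "w \<in> gwords X" using Cons.prems a by auto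
  have "pres_class X R ([a] @ (w @ w') @ [(i, \<not> b)]) = pres_class X R ([a] @ [] @ [(i, \<not> b)])"
    using X w' a by (intro pres_class_context) auto
  moreover have "pres_class X R (w' @ [(i, \<not> b), a] @ w) = pres_class X R (w' @ [] @ w)"
    using X w' a pres_class_cancel[of i X R "\<not> b"] by (intro pres_class_context) auto
  ultimately show ?case
    using w' X a pres_class_cancel[of i X R b] by (intro bexI[of _ "w' @ [(i, \<not> b)]"]) auto
qed

text \<open>An idempotent of a group is its unit. In \<open>cls_wd_seg\<close> this makes the words
  of identity arrows trivial.\<close>

lemma pres_class_idem:
  assumes "w \<in> gwords X" "pres_class X R (w @ w) = pres_class X R w"
  shows "pres_class X R w = pres_class X R []"
proof -
  obtain w' where w': "w' \<in> gwords X" "pres_class X R (w @ w') = pres_class X R []"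
    using ex_inverse_word assms by blast
  have "pres_class X R (w @ []) = pres_class X R (w @ w @ w')"
    using w' assms by (intro pres_class_append_cong) auto
  also have "\<dots> = pres_class X R ((w @ w) @ w')"
    by simp
  also have "\<dots> = pres_class X R (w @ w')"
    using w' assms by (intro pres_class_append_cong) auto
  finally show ?thesis using w' by simp
qed

locale pi1_setup = tree_setup S M W D T
  for S :: "'s set" and M :: "'s \<Rightarrow> 's \<Rightarrow> enat" and W :: "('s, 'c, 'e) weyl_data"
    and D :: "('s, 'c, 'e) gen_data" and T :: "('s \<times> 'e) set" +
  fixes RB :: "'s \<Rightarrow> 'c \<Rightarrow> ('e gword \<times> 'e gword) set"
  assumes base_rels: "is_base_relations S W D RB"
begin

abbreviation gens :: "('s \<times> 'e) set" where
  "gens \<equiv> generating_set S W D"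

abbreviation rels :: "(('s \<times> 'e) gword \<times> ('s \<times> 'e) gword) set" where
  "rels \<equiv> pi1_relations S M W D RB T"

abbreviation cls :: "('s \<times> 'e) gword \<Rightarrow> ('s \<times> 'e) gword set" where
  "cls \<equiv> pres_class gens rels"

text \<open>The initial chamber of a gallery does not enter its expression, so words are attached to
  bare edge sequences.\<close>

definition wd :: "('s \<times> 'e) list \<Rightarrow> ('s \<times> 'e) gword" where
  "wd p = pos_word (concat (map (edge_expr W D) p))"

lemma wd_simps [simp]:
  "wd [] = []" "wd (i # p) = pos_word (edge_expr W D i) @ wd p" "wd (p @ q) = wd p @ wd q"
  by (simp_all add: wd_def)

lemma wd_gwords: "set p \<subseteq> edges S W \<Longrightarrow> wd p \<in> gwords gens"
  using edge_expr_generators by (induction p) auto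

lemma path_wd_gwords: "path x p \<Longrightarrow> wd p \<in> gwords gens"
  using wd_gwords is_path_edges by blast

lemma cls_relation: "\<lbrakk>(l, r) \<in> rels; l \<in> gwords gens; r \<in> gwords gens\<rbrakk> \<Longrightarrow> cls l = cls r"
  by (intro pres_class_eqI pres_cong.relation)

lemma cls_inverse:
  assumes "i \<in> gens_pos S W D"
  shows "cls (pos_word [i, einv W i]) = cls []"
proof (rule cls_relation)
  show "(pos_word [i, einv W i], []) \<in> rels"
    using assms unfolding pi1_relations_def inverse_relations_def by blast
  show "pos_word [i, einv W i] \<in> gwords gens"
    using assms by (auto simp: generating_set_def gens_neg_iff)
qed simp

section \<open>The local groups at the base chambers\<close>

abbreviation loop_gens :: "'s \<Rightarrow> 'c \<Rightarrow> 'e set" where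
  "loop_gens s b \<equiv> carrier (local_group (panels W s) b) - {gid (panels W s) b}"

text \<open>The map \<open>\<phi>\<close> is the isomorphism from \<open>defining_relations\<close>
  after the class map. Read from values to congruence, the last clause makes the multiplication of
  the local group a consequence of \<open>RB\<close>; read backwards, it makes the relations of
  \<open>RB\<close> true in the local group.\<close>

lemma base_eval:
  assumes "s \<in> S" "b \<in> base D s"
  obtains \<phi> where
    "\<And>u. u \<in> gwords (loop_gens s b) \<Longrightarrow> \<phi> u \<in> carrier (local_group (panels W s) b)"
    "\<And>u v. u \<in> gwords (loop_gens s b) \<Longrightarrow> v \<in> gwords (loop_gens s b) \<Longrightarrow>
      \<phi> (u @ v) = gcomp (panels W s) (\<phi> u) (\<phi> v)"
    "\<phi> [] = gid (panels W s) b"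
    "\<And>g. g \<in> loop_gens s b \<Longrightarrow> \<phi> [(g, True)] = g"
    "\<And>u v. u \<in> gwords (loop_gens s b) \<Longrightarrow> v \<in> gwords (loop_gens s b) \<Longrightarrow>
      \<phi> u = \<phi> v \<longleftrightarrow> (u, v) \<in> pres_cong (loop_gens s b) (RB s b)"
proof -
  interpret P: grpd "panels W s" using panel_grpd assms by blast
  define H where "H = local_group (panels W s) b"
  let ?X = "loop_gens s b" and ?R = "RB s b"
  let ?G = "presented_group ?X ?R"
  have "defining_relations H ?X ?R"
    using base_rels assms by (simp add: is_base_relations_def H_def Let_def local_group_def)
  then obtain h where h: "h \<in> iso ?G H" "\<And>x. x \<in> ?X \<Longrightarrow> h (pres_class ?X ?R [(x, True)]) = x"
    unfolding defining_relations_def by blast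
  define \<phi> where "\<phi> u = h (pres_class ?X ?R u)" for u
  have in_G: "pres_class ?X ?R u \<in> carrier ?G" if "u \<in> gwords ?X" for u
    using that by (simp add: carrier_presented_group)
  have carrier: "\<phi> u \<in> carrier H" if "u \<in> gwords ?X" for u
    using h(1) in_G[OF that] by (auto simp: \<phi>_def iso_def hom_def)
  have mult: "\<phi> (u @ v) = gcomp (panels W s) (\<phi> u) (\<phi> v)"
    if "u \<in> gwords ?X" "v \<in> gwords ?X" for u v
  proof -
    have "\<phi> (u @ v) = h (pres_class ?X ?R u \<otimes>\<^bsub>?G\<^esub> pres_class ?X ?R v)"
      using that by (simp add: \<phi>_def mult_presented_group)
    also have "\<dots> = \<phi> u \<otimes>\<^bsub>H\<^esub> \<phi> v"
      using h(1) in_G that unfolding \<phi>_def iso_def hom_def by blast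
    finally show ?thesis by (simp add: H_def local_group_def)
  qed
  \<comment> \<open>Being in \<open>hom\<close> says nothing about units; \<open>\<phi> []\<close>
    is recognised as an idempotent arrow and cancelled against its inverse.\<close>
  have "\<phi> [] \<in> carrier H" "gcomp (panels W s) (\<phi> []) (\<phi> []) = \<phi> []"
    using carrier[of "[]"] mult[of "[]" "[]"] by simp_all
  then have unit: "\<phi> [] = gid (panels W s) b"
    using P.inv_comp_cancel_left[of "\<phi> []" "\<phi> []"] P.inv_comp[of "\<phi> []"]
    by (auto simp: H_def local_group_def)
  have eq: "\<phi> u = \<phi> v \<longleftrightarrow> (u, v) \<in> pres_cong ?X ?R" if "u \<in> gwords ?X" "v \<in> gwords ?X" for u v
  proof -
    have "inj_on h (carrier ?G)"
      using h(1) by (auto simp: iso_def bij_betw_def)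
    then show ?thesis
      using inj_on_eq_iff[OF _ in_G[OF that(1)] in_G[OF that(2)]] pres_class_eq_iff[OF that]
      by (simp add: \<phi>_def)
  qed
  show ?thesis
    by (rule that[of \<phi>]) (use carrier mult unit eq h(2) in \<open>auto simp: \<phi>_def H_def\<close>)
qed

lemma tag_word_map: "tag_word s w = map (map_prod (Pair s) id) w"
  by (induction w) (auto simp: tag_word_def)

lemma tag_loop_gens:
  assumes "s \<in> S" "b \<in> base D s"
  shows "Pair s ` loop_gens s b \<subseteq> gens"
proof -
  interpret P: grpd "panels W s" using panel_grpd assms by blast
  show ?thesis
    using assms
    by (auto simp: local_group_def generating_set_def gens_loops_def base_loops_def gids_def P.src_id)
qed

text \<open>Both sides have the same value under \<open>\<phi>\<close>, hence are congruent modulo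
  \<open>RB\<close>, and tagging with \<open>s\<close> carries this into the large
  presentation.\<close>

lemma cls_seg_loop_comp:
  assumes "s \<in> S" "b \<in> base D s"
    and "g \<in> carrier (local_group (panels W s) b)" "g' \<in> carrier (local_group (panels W s) b)"
  shows "cls (pos_word (seg s g @ seg s g')) = cls (pos_word (seg s (gcomp (panels W s) g g')))"
proof -
  interpret P: grpd "panels W s" using panel_grpd assms by blast
  obtain \<phi> where \<phi>: "\<And>u. u \<in> gwords (loop_gens s b) \<Longrightarrow> \<phi> u \<in> carrier (local_group (panels W s) b)"
    "\<And>u v. u \<in> gwords (loop_gens s b) \<Longrightarrow> v \<in> gwords (loop_gens s b) \<Longrightarrow>
      \<phi> (u @ v) = gcomp (panels W s) (\<phi> u) (\<phi> v)"
    "\<phi> [] = gid (panels W s) b"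
    "\<And>g. g \<in> loop_gens s b \<Longrightarrow> \<phi> [(g, True)] = g"
    "\<And>u v. u \<in> gwords (loop_gens s b) \<Longrightarrow> v \<in> gwords (loop_gens s b) \<Longrightarrow>
      \<phi> u = \<phi> v \<longleftrightarrow> (u, v) \<in> pres_cong (loop_gens s b) (RB s b)"
    using base_eval[OF assms(1,2)] by blast
  \<comment> \<open>The identity at \<open>b\<close> is not a generator, so it is spelled by the
    empty word.\<close>
  define w where "w g = (if g = gid (panels W s) b then [] else [(g, True)])" for g :: 'e
  have w: "w k \<in> gwords (loop_gens s b)" "\<phi> (w k) = k" "tag_word s (w k) = pos_word (seg s k)"
    if k: "k \<in> carrier (local_group (panels W s) b)" for k
  proof -
    have "k = gid (panels W s) b \<longleftrightarrow> k \<in> gids (panels W s)"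
      using k base_in[OF assms(1,2)] panel_verts[OF assms(1)]
      by (auto simp: local_group_def gids_def P.src_id)
    then show "tag_word s (w k) = pos_word (seg s k)"
      by (simp add: w_def seg_def tag_word_def)
  qed (use k \<phi>(3,4) in \<open>auto simp: w_def\<close>)
  let ?gg' = "gcomp (panels W s) g g'"
  have gg': "?gg' \<in> carrier (local_group (panels W s) b)"
    using assms by (auto simp: local_group_def P.comp_arc P.src_comp P.trg_comp)
  have "\<phi> (w g @ w g') = \<phi> (w ?gg')"
    using w[OF assms(3)] w[OF assms(4)] w[OF gg'] \<phi>(2) by simp
  then have "(w g @ w g', w ?gg') \<in> pres_cong (loop_gens s b) (RB s b)"
    using \<phi>(5)[of "w g @ w g'" "w ?gg'"] w[OF assms(3)] w[OF assms(4)] w[OF gg'] by simp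
  then have "(tag_word s (w g @ w g'), tag_word s (w ?gg')) \<in> pres_cong gens rels"
    unfolding tag_word_map
  proof (rule pres_cong_map[OF _ tag_loop_gens[OF assms(1,2)]])
    fix l r assume lr: "(l, r) \<in> RB s b"
    have "RB s b \<subseteq> gwords (loop_gens s b) \<times> gwords (loop_gens s b)"
      using base_rels assms
      by (simp add: is_base_relations_def Let_def local_group_def defining_relations_def)
    then have "tag_word s u \<in> gwords gens" if "u \<in> {l, r}" for u
      using lr that tag_loop_gens[OF assms(1,2)]
      by (fastforce simp: tag_word_def gwords_def)
    moreover have "(tag_word s l, tag_word s r) \<in> rels"
      using lr assms unfolding pi1_relations_def base_relations_def by blast
    ultimately show "(map (map_prod (Pair s) id) l, map (map_prod (Pair s) id) r) \<in> pres_cong gens rels"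
      unfolding tag_word_map[symmetric] by (intro pres_cong.relation) auto
  qed
  then have "cls (tag_word s (w g @ w g')) = cls (tag_word s (w ?gg'))"
    by (rule pres_class_eqI)
  then show ?thesis
    using w[OF assms(3)] w[OF assms(4)] w[OF gg'] by (simp add: tag_word_map)
qed

lemma cls_root_inverse:
  assumes "s \<in> S" "C \<in> chambers W"
  shows "cls (pos_word (seg s (root s C) @ seg s (ginv (panels W s) (root s C)))) = cls []"
proof -
  interpret P: grpd "panels W s" using panel_grpd assms by blast
  show ?thesis
  proof (cases "root s C \<in> gids (panels W s)")
    case True
    then show ?thesis
      using P.inv_in_gids_iff root_arc[OF assms] by (simp add: seg_def)
  next
    case False
    then have "(s, root s C) \<in> gens_pos S W D"
      using root_in[OF assms] assms by (auto simp: gens_pos_def)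
    then show ?thesis
      using cls_inverse[of "(s, root s C)"] False P.inv_in_gids_iff root_arc[OF assms]
      by (simp add: seg_def einv_def)
  qed
qed

text \<open>Unlike \<open>edge_expr\<close>, this is meaningful for identities, too.\<close>

definition arrow_word :: "'s \<Rightarrow> 'e \<Rightarrow> ('s \<times> 'e) gword" where
  "arrow_word s e =
    pos_word (seg s (ginv (panels W s) (root s (gsrc (panels W s) e)))) @ pos_word (seg s (loop s e)) @
    pos_word (seg s (root s (gtrg (panels W s) e)))"

lemma pos_word_seg_gwords:
  "\<lbrakk>s \<in> S; e \<in> star_neg W D s \<union> base_loops W D s \<union> star_pos W D s \<union> gids (panels W s)\<rbrakk>
    \<Longrightarrow> pos_word (seg s e) \<in> gwords gens"
  using seg_generators by simp

lemma arrow_word_parts: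
  assumes "s \<in> S" "e \<in> garcs (panels W s)"
  shows "pos_word (seg s (ginv (panels W s) (root s (gsrc (panels W s) e)))) \<in> gwords gens"
    "pos_word (seg s (ginv (panels W s) (root s (gtrg (panels W s) e)))) \<in> gwords gens"
    "pos_word (seg s (loop s e)) \<in> gwords gens"
    "pos_word (seg s (root s (gtrg (panels W s) e))) \<in> gwords gens"
proof -
  have C: "gsrc (panels W s) e \<in> chambers W" "gtrg (panels W s) e \<in> chambers W"
    using grpd.src_in[OF panel_grpd] grpd.trg_in[OF panel_grpd] panel_verts assms by auto
  show "pos_word (seg s (ginv (panels W s) (root s (gsrc (panels W s) e)))) \<in> gwords gens"
    "pos_word (seg s (ginv (panels W s) (root s (gtrg (panels W s) e)))) \<in> gwords gens"
    "pos_word (seg s (loop s e)) \<in> gwords gens"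
    "pos_word (seg s (root s (gtrg (panels W s) e))) \<in> gwords gens"
    using inv_root_in[OF assms(1) C(1)] inv_root_in[OF assms(1) C(2)] loop_in[OF assms]
      root_in[OF assms(1) C(2)] assms(1)
    by (auto intro!: pos_word_seg_gwords simp del: pos_word_in_gwords)
qed

text \<open>The inverse root that closes the first factor cancels the root that opens the
  second.\<close>

lemma loop_comp:
  assumes "s \<in> S" "e \<in> garcs (panels W s)" "e' \<in> garcs (panels W s)"
    and "gtrg (panels W s) e = gsrc (panels W s) e'"
  shows "loop s (gcomp (panels W s) e e') = gcomp (panels W s) (loop s e) (loop s e')"
proof -
  interpret P: grpd "panels W s" using panel_grpd assms by blast
  have C: "gsrc (panels W s) e \<in> chambers W" "gtrg (panels W s) e \<in> chambers W"
    "gtrg (panels W s) e' \<in> chambers W"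
    using P.src_in P.trg_in panel_verts assms by auto
  show ?thesis
    using assms root_props[OF assms(1) C(1)] root_props[OF assms(1) C(2)] root_props[OF assms(1) C(3)]
    by (simp add: loop_def Let_def P.comp_assoc P.comp_arc P.ginv_props P.src_comp P.trg_comp
        P.inv_comp_cancel_left)
qed

lemma cls_arrow_word_comp:
  assumes "s \<in> S" "e \<in> garcs (panels W s)" "e' \<in> garcs (panels W s)"
    and "gtrg (panels W s) e = gsrc (panels W s) e'"
  shows "cls (arrow_word s e @ arrow_word s e') = cls (arrow_word s (gcomp (panels W s) e e'))"
proof -
  interpret P: grpd "panels W s" using panel_grpd assms by blast
  define b where "b = gsrc (panels W s) (loop s e)"
  have ee': "gcomp (panels W s) e e' \<in> garcs (panels W s)"
    "gsrc (panels W s) (gcomp (panels W s) e e') = gsrc (panels W s) e"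
    "gtrg (panels W s) (gcomp (panels W s) e e') = gtrg (panels W s) e'"
    using assms by (simp_all add: P.comp_arc P.src_comp P.trg_comp)
  have b: "b \<in> base D s" "loop s e \<in> carrier (local_group (panels W s) b)"
    "loop s e' \<in> carrier (local_group (panels W s) b)"
    using loop_props[OF assms(1,2)] loop_props[OF assms(1,3)] assms
    by (auto simp: b_def local_group_def)
  note gw = arrow_word_parts[OF assms(1,2)] arrow_word_parts[OF assms(1,3)]
    arrow_word_parts[OF assms(1) ee'(1)]
  let ?A = "pos_word (seg s (ginv (panels W s) (root s (gsrc (panels W s) e))))"
  let ?L = "pos_word (seg s (loop s e))"
  \<comment> \<open>This is the seam of the two words: the root of the common chamber followed by
    its inverse. Once it vanishes, \<open>?L\<close> and \<open>?L'\<close> are adjacent and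
    multiply in the local group.\<close>
  let ?N = "pos_word (seg s (root s (gtrg (panels W s) e)) @
    seg s (ginv (panels W s) (root s (gtrg (panels W s) e))))"
  let ?L' = "pos_word (seg s (loop s e'))"
  let ?R = "pos_word (seg s (root s (gtrg (panels W s) e')))"
  have "cls ((?A @ ?L) @ ?N @ (?L' @ ?R)) = cls ((?A @ ?L) @ [] @ (?L' @ ?R))"
    using gw cls_root_inverse[OF assms(1), of "gtrg (panels W s) e"] P.trg_in[OF assms(2)]
      panel_verts[OF assms(1)]
    by (intro pres_class_context) (auto simp del: pos_word_in_gwords)
  also have "\<dots> = cls (?A @ (?L @ ?L') @ ?R)"
    by simp
  also have "\<dots> = cls (?A @ pos_word (seg s (loop s (gcomp (panels W s) e e'))) @ ?R)"
    using gw cls_seg_loop_comp[OF assms(1) b] loop_comp[OF assms]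
    by (intro pres_class_context) (auto simp del: pos_word_in_gwords)
  finally show ?thesis
    using assms(4) ee' by (simp add: arrow_word_def)
qed

text \<open>For an edge this is \<open>edge_expr_root\<close>. For an identity arrow away from the
  base chambers, \<open>arrow_word\<close> consists of an inverse root and a root, while the path is
  empty; the two agree because the composition law makes \<open>arrow_word\<close>
  idempotent.\<close>

lemma cls_wd_seg:
  assumes "s \<in> S" "e \<in> garcs (panels W s)"
  shows "cls (wd (seg s e)) = cls (arrow_word s e)"
proof -
  interpret P: grpd "panels W s" using panel_grpd assms by blast
  have gw: "arrow_word s e \<in> gwords gens"
    using arrow_word_parts[OF assms] by (simp add: arrow_word_def del: pos_word_in_gwords)
  show ?thesis
  proof (cases "e \<in> gids (panels W s)")
    case True
    then have "gcomp (panels W s) e e = e"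
      using P.gids_comp[OF True assms(2)] P.src_eq_trg_gids by blast
    then have "cls (arrow_word s e @ arrow_word s e) = cls (arrow_word s e)"
      using cls_arrow_word_comp[of s e e] assms P.src_eq_trg_gids[OF True] by simp
    then show ?thesis
      using pres_class_idem[OF gw] True by (simp add: seg_def)
  next
    case False
    then show ?thesis
      using assms by (simp add: seg_def edge_expr_root edges_iff arrow_word_def)
  qed
qed

lemma cls_wd_seg_comp:
  assumes "s \<in> S" "e \<in> garcs (panels W s)" "e' \<in> garcs (panels W s)"
    and "gtrg (panels W s) e = gsrc (panels W s) e'"
  shows "cls (wd (seg s e @ seg s e')) = cls (wd (seg s (gcomp (panels W s) e e')))"
proof -
  have gw: "arrow_word s g \<in> gwords gens" "wd (seg s g) \<in> gwords gens"
    if "g \<in> garcs (panels W s)" for g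
    using arrow_word_parts[OF assms(1) that] path_wd_gwords[OF seg_path(1)[OF assms(1) that]]
    by (simp_all add: arrow_word_def del: pos_word_in_gwords)
  have "cls (wd (seg s e) @ wd (seg s e')) = cls (arrow_word s e @ arrow_word s e')"
    using gw cls_wd_seg assms by (intro pres_class_append_cong) auto
  also have "\<dots> = cls (wd (seg s (gcomp (panels W s) e e')))"
    using cls_wd_seg[OF assms(1)] grpd.comp_arc[OF panel_grpd] cls_arrow_word_comp[OF assms] assms
    by simp
  finally show ?thesis by simp
qed

section \<open>Homotopy invariance of the word of a path\<close>

lemma cls_wd_context:
  assumes "cls (wd p) = cls (wd q)" "set u \<subseteq> edges S W" "set p \<subseteq> edges S W"
    "set q \<subseteq> edges S W" "set v \<subseteq> edges S W"
  shows "cls (wd (u @ p @ v)) = cls (wd (u @ q @ v))"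
  unfolding wd_simps using assms by (intro pres_class_context) (simp_all add: wd_gwords)

text \<open>This is the instance of the composition law whose composite is an identity, with an
  empty segment.\<close>

lemma cls_wd_backtrack:
  assumes "i \<in> edges S W"
  shows "cls (wd [i, einv W i]) = cls []"
proof -
  obtain s e where i: "i = (s, e)" by fastforce
  have e: "s \<in> S" "e \<in> garcs (panels W s)" "e \<notin> gids (panels W s)"
    using assms i by (auto simp: edges_iff)
  interpret P: grpd "panels W s" using panel_grpd e by blast
  have "gcomp (panels W s) e (ginv (panels W s) e) \<in> gids (panels W s)"
    using e by (simp add: P.comp_inv gids_def P.src_in)
  then show ?thesis
    using cls_wd_seg_comp[of s e "ginv (panels W s) e"] e i
    by (simp add: seg_def P.ginv_props P.inv_in_gids_iff einv_def)
qed

lemma cls_wd_suite: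
  assumes "\<delta> \<in> defining_suites S M W"
  shows "cls (wd (snd \<delta>)) = cls []"
proof (rule cls_relation)
  show "(wd (snd \<delta>), []) \<in> rels"
    using assms unfolding pi1_relations_def suite_relations_def gal_expr_def wd_def by blast
  show "wd (snd \<delta>) \<in> gwords gens"
    using path_wd_gwords defining_suite_closed[OF assms] by blast
qed simp

lemma elem_homotopy_cls_eq:
  assumes "((x, p), (y, q)) \<in> elem_homotopy S M W"
  shows "cls (wd p) = cls (wd q)"
proof -
  have edges: "set p \<subseteq> edges S W" "set q \<subseteq> edges S W"
    using elem_homotopy_ends[OF assms] is_path_edges by blast+
  from assms show ?thesis
  proof cases
    case (backtrack u i v)
    have "cls (wd (u @ [i, einv W i] @ v)) = cls (wd (u @ [] @ v))"
      using edges backtrack cls_wd_backtrack[of i] by (intro cls_wd_context) auto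
    then show ?thesis using backtrack by simp
  next
    case (merge u s i i' v)
    then have i: "(s, i) \<in> edges S W" "(s, i') \<in> edges S W"
      "gtrg (panels W s) i = gsrc (panels W s) i'"
      by (auto simp: esrc_def etrg_def)
    then interpret P: grpd "panels W s"
      by (auto simp: edges_iff intro: panel_grpd)
    have "gcomp (panels W s) i i' \<notin> gids (panels W s)"
      using i merge P.comp_in_gids_iff by (auto simp: edges_iff)
    then have "cls (wd [(s, i), (s, i')]) = cls (wd [(s, gcomp (panels W s) i i')])"
      using cls_wd_seg_comp[of s i i'] i by (simp add: seg_def edges_iff)
    then have "cls (wd (u @ [(s, i), (s, i')] @ v)) = cls (wd (u @ [(s, gcomp (panels W s) i i')] @ v))"
      using edges merge by (intro cls_wd_context) auto
    then show ?thesis using merge by simp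
  next
    case (suite u \<delta> v)
    have "cls (wd (u @ snd \<delta> @ v)) = cls (wd (u @ [] @ v))"
      using edges suite cls_wd_suite[of \<delta>] by (intro cls_wd_context) auto
    then show ?thesis using suite by simp
  qed
qed

lemma homotopy_cls_eq:
  assumes "(b, c) \<in> homotopy S M W"
  shows "cls (wd (snd b)) = cls (wd (snd c))"
proof -
  have "(b, c) \<in> (elem_homotopy S M W \<union> (elem_homotopy S M W)\<inverse>)\<^sup>*"
    using assms by (simp add: homotopy_def)
  then show ?thesis
  proof (induction rule: rtrancl_induct)
    case (step c d)
    then have "cls (wd (snd c)) = cls (wd (snd d))"
      using elem_homotopy_cls_eq[of "fst c" "snd c" "fst d" "snd d"]
        elem_homotopy_cls_eq[of "fst d" "snd d" "fst c" "snd c"] by auto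
    then show ?case using step.IH by simp
  qed simp
qed

lemma cls_wd_tree:
  assumes "set p \<subseteq> T"
  shows "cls (wd p) = cls []"
  using assms
proof (induction p)
  case (Cons t p)
  then have "t \<in> T" by simp
  then have t: "t \<in> gens" "(pos_word [t], []) \<in> rels"
    using tree_gens[of t] unfolding generating_set_def pi1_relations_def tree_relations_def by blast+
  have "cls (pos_word [t]) = cls []"
    using t by (intro cls_relation) auto
  moreover have "wd p \<in> gwords gens"
    using Cons.prems tree_edge by (intro wd_gwords) auto
  ultimately have "cls (pos_word [t] @ wd p) = cls ([] @ [])"
    using Cons t by (intro pres_class_append_cong) auto
  then show ?case
    using edge_expr_generator[OF t(1)] by simp
qed simp

lemma cls_wd_tree_context:
  assumes "set p \<subseteq> T" "set r \<subseteq> T" "set q \<subseteq> edges S W"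
  shows "cls (wd (p @ q @ r)) = cls (wd q)"
proof -
  have edges: "set p \<subseteq> edges S W" "set r \<subseteq> edges S W"
    using assms tree_edge by auto
  have "cls (wd p @ wd q @ wd r) = cls ([] @ wd q @ [])"
    using assms edges cls_wd_tree wd_gwords by (intro pres_class_append_cong) auto
  then show ?thesis by simp
qed

text \<open>An arbitrary path in the tree is chosen; it may contain backtracks, and
  \<open>tree_path x x\<close> may be non-empty. By \<open>tree_closed_path\<close> this does no
  harm up to homotopy.\<close>

definition tree_path :: "'c \<Rightarrow> 'c \<Rightarrow> ('s \<times> 'e) list" where
  "tree_path x y = (SOME p. path x p \<and> gal_term W (x, p) = y \<and> set p \<subseteq> T)"

lemma tree_path_props:
  assumes "x \<in> chambers W" "y \<in> chambers W"
  shows path_tree_path: "path x (tree_path x y)"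
    and tree_path_end: "gal_term W (x, tree_path x y) = y"
    and tree_path_subset: "set (tree_path x y) \<subseteq> T"
proof -
  have "\<exists>p. path x p \<and> gal_term W (x, p) = y \<and> set p \<subseteq> T"
    using tree_path_ex[OF assms] by metis
  from someI_ex[OF this]
  show "path x (tree_path x y)" "gal_term W (x, tree_path x y) = y" "set (tree_path x y) \<subseteq> T"
    by (simp_all add: tree_path_def)
qed

text \<open>The way back is the reverse of the chosen way out to the final chamber, not a new
  choice. In a concatenation of two such loops, the return of the first therefore cancels literally
  against the way out of the second.\<close>

definition conj_path :: "'c \<Rightarrow> 'c \<Rightarrow> ('s \<times> 'e) list \<Rightarrow> ('s \<times> 'e) list" where
  "conj_path x y p = tree_path x y @ p @ rpath (tree_path x (gal_term W (y, p)))"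

lemma path_conj_path:
  assumes "x \<in> chambers W" "path y p"
  shows "path x (conj_path x y p)" "gal_term W (x, conj_path x y p) = x"
proof -
  have y: "y \<in> chambers W" "gal_term W (y, p) \<in> chambers W"
    using is_path_start is_path_end assms by blast+
  note t = tree_path_props[OF assms(1) y(1)] tree_path_props[OF assms(1) y(2)]
  show "path x (conj_path x y p)" "gal_term W (x, conj_path x y p) = x"
    using t assms path_rpath[OF t(4)] by (simp_all add: conj_path_def)
qed

lemma hclass_conj_path_append:
  assumes "x \<in> chambers W" "path y p" "path z q" "z = gal_term W (y, p)"
  shows "hcl x (conj_path x y p @ conj_path x z q) = hcl x (conj_path x y (p @ q))"
proof -
  have C: "y \<in> chambers W" "z \<in> chambers W" "gal_term W (z, q) \<in> chambers W"
    using is_path_start is_path_end assms by blast+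
  note t = tree_path_props[OF assms(1) C(1)] tree_path_props[OF assms(1) C(2)]
    tree_path_props[OF assms(1) C(3)]
  let ?t = "tree_path x z"
  have "hcl x ((tree_path x y @ p) @ (rpath ?t @ ?t) @ (q @ rpath (tree_path x (gal_term W (z, q))))) =
      hcl x ((tree_path x y @ p) @ [] @ (q @ rpath (tree_path x (gal_term W (z, q)))))"
    using t assms C path_rpath[OF t(4)] path_rpath[OF t(7)] hclass_rpath_append[OF t(4)]
    by (intro hclass_context[of z]) auto
  then show ?thesis
    using assms(4) by (simp add: conj_path_def)
qed

lemma hclass_conj_path_cong:
  assumes "x \<in> chambers W" "path y p" "path y q" "hcl y p = hcl y q"
  shows "hcl x (conj_path x y p) = hcl x (conj_path x y q)"
proof -
  have end_eq: "gal_term W (y, q) = gal_term W (y, p)"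
    using hclass_eqD(2)[OF assms(4,2,3)] .
  have C: "y \<in> chambers W" "gal_term W (y, p) \<in> chambers W"
    using is_path_start is_path_end assms by blast+
  note t = tree_path_props[OF assms(1) C(1)] tree_path_props[OF assms(1) C(2)]
  show ?thesis
    unfolding conj_path_def end_eq
    using t assms path_rpath[OF t(4)] by (intro hclass_context[of y]) auto
qed

lemma hclass_conj_path_Nil:
  assumes "x \<in> chambers W" "y \<in> chambers W"
  shows "hcl x (conj_path x y []) = hcl x []"
  using hclass_append_rpath[OF path_tree_path[OF assms]] by (simp add: conj_path_def)

text \<open>Acyclicity of the tree enters here: \<open>tree_path x x\<close> is a closed path in the
  tree and hence null-homotopic, and so is its reverse.\<close>

lemma hclass_conj_path_loop:
  assumes "path x p" "gal_term W (x, p) = x"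
  shows "hcl x (conj_path x x p) = hcl x p"
proof -
  have x: "x \<in> chambers W" using assms(1) is_path_start by blast
  note t = tree_path_props[OF x x]
  have triv: "hcl x (tree_path x x) = hcl x []" "hcl x (rpath (tree_path x x)) = hcl x []"
    using t path_rpath[OF t(1)] rpath_tree[OF t(3)] by (simp_all add: tree_closed_path)
  have "hcl x (tree_path x x @ (p @ rpath (tree_path x x))) = hcl x ([] @ (p @ rpath (tree_path x x)))"
    using t path_rpath[OF t(1)] triv assms x by (intro hclass_append_cong[of x _ _ x]) auto
  also have "\<dots> = hcl x (p @ [])"
    using t path_rpath[OF t(1)] triv assms x
    by (simp, intro hclass_append_cong[of x p p x _ "[]", simplified]) auto
  finally show ?thesis using assms(2) by (simp add: conj_path_def)
qed

section \<open>From words to loops at a fixed chamber\<close>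

fun letter_path :: "'c \<Rightarrow> ('s \<times> 'e) \<times> bool \<Rightarrow> ('s \<times> 'e) list" where
  "letter_path x (i, True) = conj_path x (esrc W i) [i]"
| "letter_path x (i, False) = conj_path x (etrg W i) [einv W i]"

definition word_path :: "'c \<Rightarrow> ('s \<times> 'e) gword \<Rightarrow> ('s \<times> 'e) list" where
  "word_path x w = concat (map (letter_path x) w)"

lemma word_path_simps [simp]:
  "word_path x [] = []" "word_path x (a # w) = letter_path x a @ word_path x w"
  "word_path x (v @ w) = word_path x v @ word_path x w"
  by (simp_all add: word_path_def)

lemma edge_path: "i \<in> edges S W \<Longrightarrow> path (esrc W i) [i]"
  by (simp add: etrg_in)

lemma path_letter_path:
  assumes "x \<in> chambers W" "i \<in> edges S W"
  shows "path x (letter_path x (i, b))" "gal_term W (x, letter_path x (i, b)) = x"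
  using assms path_conj_path[OF assms(1) edge_path[OF assms(2)]]
    path_conj_path[OF assms(1) edge_path[OF einv_edge[OF assms(2)]]]
  by (cases b; simp add: esrc_einv)+

lemma path_word_path:
  assumes "x \<in> chambers W" "w \<in> gwords gens"
  shows "path x (word_path x w)" "gal_term W (x, word_path x w) = x"
proof -
  have "path x (word_path x w) \<and> gal_term W (x, word_path x w) = x"
    using assms(2)
  proof (induction w)
    case (Cons a w)
    obtain i b where "a = (i, b)" by fastforce
    then have "path x (letter_path x a) \<and> gal_term W (x, letter_path x a) = x"
      using Cons.prems path_letter_path[OF assms(1) generating_set_edge[of i]] by simp
    then show ?case
      using Cons by simp
  qed (use assms in simp)
  then show "path x (word_path x w)" "gal_term W (x, word_path x w) = x"
    by blast+
qed

lemma hclass_loop_append_cong: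
  assumes "hcl x p = hcl x p'" "hcl x q = hcl x q'"
    and "path x p" "path x p'" "path x q" "path x q'" "gal_term W (x, p) = x"
  shows "hcl x (p @ q) = hcl x (p' @ q')"
  using assms by (intro hclass_append_cong[of x p p' x]) auto

lemma hclass_letter_cancel:
  assumes "x \<in> chambers W" "i \<in> edges S W"
  shows "hcl x (letter_path x (i, b) @ letter_path x (i, \<not> b)) = hcl x []"
proof -
  have "hcl x (conj_path x (esrc W j) [j] @ conj_path x (etrg W j) [einv W j]) = hcl x []"
    if j: "j \<in> edges S W" for j
  proof -
    have "hcl x (conj_path x (esrc W j) [j] @ conj_path x (etrg W j) [einv W j]) =
        hcl x (conj_path x (esrc W j) ([j] @ [einv W j]))"
      using assms j by (intro hclass_conj_path_append) (auto simp: einv_props esrc_in etrg_in)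
    also have "\<dots> = hcl x (conj_path x (esrc W j) [])"
      using assms j hclass_backtrack[OF j]
      by (intro hclass_conj_path_cong) (auto simp: einv_props esrc_in etrg_in)
    finally show ?thesis
      using hclass_conj_path_Nil assms(1) esrc_in[OF j] by simp
  qed
  \<comment> \<open>Applying the claim to \<open>einv W i\<close> settles the case in which the
    inverse letter comes first.\<close>
  from this[OF assms(2)] this[OF einv_edge[OF assms(2)]] show ?thesis
    using assms(2) by (cases b) (simp_all add: einv_props)
qed

lemma word_path_seg:
  assumes "x \<in> chambers W" "s \<in> S" "e \<in> garcs (panels W s)"
  shows "hcl x (word_path x (pos_word (seg s e))) =
    hcl x (conj_path x (gsrc (panels W s) e) (seg s e))"
proof (cases "e \<in> gids (panels W s)")
  case True
  have "gsrc (panels W s) e \<in> chambers W"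
    using grpd.src_in[OF panel_grpd] panel_verts assms by auto
  then show ?thesis
    using True hclass_conj_path_Nil assms(1) by (simp add: seg_def)
next
  case False
  then show ?thesis by (simp add: seg_def esrc_def)
qed

text \<open>The loops of the three factors concatenate to the loop of the path through the base
  chamber, which is homotopic to \<open>[i]\<close> inside one panel.\<close>

lemma word_path_edge_expr:
  assumes "x \<in> chambers W" "i \<in> edges S W"
  shows "hcl x (word_path x (pos_word (edge_expr W D i))) = hcl x (conj_path x (esrc W i) [i])"
proof -
  obtain s e where i: "i = (s, e)" by fastforce
  then have e: "s \<in> S" "e \<in> garcs (panels W s)" "e \<notin> gids (panels W s)"
    using assms(2) by (auto simp: edges_iff)
  interpret P: grpd "panels W s" using panel_grpd e by blast
  have C: "gsrc (panels W s) e \<in> chambers W" "gtrg (panels W s) e \<in> chambers W"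
    using P.src_in P.trg_in panel_verts e by auto
  define a where "a = ginv (panels W s) (root s (gsrc (panels W s) e))"
  define b where "b = loop s e"
  define c where "c = root s (gtrg (panels W s) e)"
  have arcs: "a \<in> garcs (panels W s)" "b \<in> garcs (panels W s)" "c \<in> garcs (panels W s)"
    and ends: "gsrc (panels W s) a = gsrc (panels W s) e" "gtrg (panels W s) a = gsrc (panels W s) b"
      "gtrg (panels W s) b = gsrc (panels W s) c"
    using root_props[OF e(1) C(1)] root_props[OF e(1) C(2)] loop_props[OF e(1,2)]
    by (simp_all add: a_def b_def c_def P.ginv_props)
  have abc: "gcomp (panels W s) (gcomp (panels W s) a b) c = e"
    using root_loop_root[OF e(1,2)] by (simp add: a_def b_def c_def)
  have gw: "pos_word (seg s a) \<in> gwords gens" "pos_word (seg s b) \<in> gwords gens"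
    "pos_word (seg s c) \<in> gwords gens"
    using arrow_word_parts[OF e(1,2)] by (simp_all add: a_def b_def c_def)
  note pa = seg_path[OF e(1) arcs(1)] and pb = seg_path[OF e(1) arcs(2)] and pc = seg_path[OF e(1) arcs(3)]
  let ?x = "gsrc (panels W s) e" and ?y = "gsrc (panels W s) b" and ?z = "gsrc (panels W s) c"
  note wp = path_word_path[OF assms(1) gw(1)] path_word_path[OF assms(1) gw(2)]
    path_word_path[OF assms(1) gw(3)]
  have cp: "path x (conj_path x ?x (seg s a))" "gal_term W (x, conj_path x ?x (seg s a)) = x"
    "path x (conj_path x ?y (seg s b))" "gal_term W (x, conj_path x ?y (seg s b)) = x"
    "path x (conj_path x ?z (seg s c))" "path x (conj_path x ?y (seg s b @ seg s c))"
    using path_conj_path[OF assms(1)] pa pb pc ends by simp_all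
  have eqs: "hcl x (word_path x (pos_word (seg s a))) = hcl x (conj_path x ?x (seg s a))"
    "hcl x (word_path x (pos_word (seg s b))) = hcl x (conj_path x ?y (seg s b))"
    "hcl x (word_path x (pos_word (seg s c))) = hcl x (conj_path x ?z (seg s c))"
    using word_path_seg[OF assms(1) e(1) arcs(1)] word_path_seg[OF assms(1) e(1) arcs(2)]
      word_path_seg[OF assms(1) e(1) arcs(3)] ends(1) by simp_all
  have "hcl x (word_path x (pos_word (seg s b)) @ word_path x (pos_word (seg s c))) =
      hcl x (conj_path x ?y (seg s b) @ conj_path x ?z (seg s c))"
    by (rule hclass_loop_append_cong[OF eqs(2,3) wp(3) cp(3) wp(5) cp(5) wp(4)])
  also have "\<dots> = hcl x (conj_path x ?y (seg s b @ seg s c))"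
    using pb pc ends assms(1) by (simp add: hclass_conj_path_append)
  finally have bc: "hcl x (word_path x (pos_word (seg s b)) @ word_path x (pos_word (seg s c))) =
      hcl x (conj_path x ?y (seg s b @ seg s c))" .
  have "hcl x (word_path x (pos_word (edge_expr W D i))) = hcl x (word_path x (pos_word (seg s a)) @
      (word_path x (pos_word (seg s b)) @ word_path x (pos_word (seg s c))))"
    using assms(2) i by (simp add: edge_expr_root a_def b_def c_def)
  also have "\<dots> = hcl x (conj_path x ?x (seg s a) @ conj_path x ?y (seg s b @ seg s c))"
    using wp by (intro hclass_loop_append_cong[OF eqs(1) bc wp(1) cp(1) _ cp(6) wp(2)]) simp
  also have "\<dots> = hcl x (conj_path x ?x (seg s a @ seg s b @ seg s c))"
    using pa pb pc ends assms(1) by (simp add: hclass_conj_path_append)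
  also have "\<dots> = hcl x (conj_path x ?x [i])"
  \<comment> \<open>Before conjugation, the three segments are composed to \<open>e\<close>, two at
    a time.\<close>
  proof (intro hclass_conj_path_cong)
    have "hcl ?x ((seg s a @ seg s b) @ seg s c) = hcl ?x (seg s (gcomp (panels W s) a b) @ seg s c)"
      using pa pb pc ends arcs hclass_seg_comp[OF e(1) arcs(1,2)]
        seg_path[OF e(1) P.comp_arc[OF arcs(1,2) ends(2)]]
      by (intro hclass_append_cong[of ?x _ _ ?z]) (simp_all add: P.src_comp P.trg_comp)
    also have "\<dots> = hcl ?x (seg s e)"
      using hclass_seg_comp[OF e(1) P.comp_arc[OF arcs(1,2) ends(2)] arcs(3)] arcs ends abc
      by (simp add: P.src_comp P.trg_comp)
    finally show "hcl ?x (seg s a @ seg s b @ seg s c) = hcl ?x [i]"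
      using e i by (simp add: seg_def)
    show "path ?x [i]"
      using edge_path[OF assms(2)] i by (simp add: esrc_def)
  qed (use assms(1) pa pb pc ends in simp_all)
  finally show ?thesis
    using i by (simp add: esrc_def)
qed

text \<open>Passing from a path to its word and back to a loop amounts to conjugation through the
  tree. For loops at \<open>x\<close> this recovers the homotopy class, whence injectivity.\<close>

lemma word_path_wd:
  assumes "x \<in> chambers W" "path y p"
  shows "hcl x (word_path x (wd p)) = hcl x (conj_path x y p)"
  using assms(2)
proof (induction p arbitrary: y)
  case Nil
  then show ?case using hclass_conj_path_Nil assms(1) by simp
next
  case (Cons i p)
  then have i: "i \<in> edges S W" "esrc W i = y" "path (etrg W i) p" by auto
  have gw: "pos_word (edge_expr W D i) \<in> gwords gens" "wd p \<in> gwords gens"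
    using edge_expr_generators[OF i(1)] path_wd_gwords[OF i(3)] by simp_all
  have "hcl x (word_path x (pos_word (edge_expr W D i)) @ word_path x (wd p)) =
      hcl x (conj_path x y [i] @ conj_path x (etrg W i) p)"
    using word_path_edge_expr[OF assms(1) i(1)] Cons.IH[OF i(3)] i(2)
      path_word_path[OF assms(1) gw(1)] path_word_path[OF assms(1) gw(2)]
      path_conj_path[OF assms(1) edge_path[OF i(1)]] path_conj_path[OF assms(1) i(3)]
    by (intro hclass_loop_append_cong) auto
  also have "\<dots> = hcl x (conj_path x y ([i] @ p))"
    using assms(1) i edge_path[OF i(1)] by (intro hclass_conj_path_append) auto
  finally show ?case by simp
qed

section \<open>The relations hold among the loops\<close>

lemma tag_word_gwords:
  assumes "s \<in> S" "b \<in> base D s" "u \<in> gwords (loop_gens s b)"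
  shows "tag_word s u \<in> gwords gens"
  using assms(3) tag_loop_gens[OF assms(1,2)]
  by (induction u) (auto simp: tag_word_def)

text \<open>Up to homotopy, the loop of a tagged word depends only on the value of the word under
  \<open>\<phi>\<close>, and the two sides of a relation in \<open>RB\<close> have the same
  value.\<close>

lemma word_path_base_relation:
  assumes "x \<in> chambers W" "s \<in> S" "b \<in> base D s" "(l, r) \<in> RB s b"
  shows "hcl x (word_path x (tag_word s l)) = hcl x (word_path x (tag_word s r))"
proof -
  interpret P: grpd "panels W s" using panel_grpd assms by blast
  let ?X = "loop_gens s b"
  obtain \<phi> where \<phi>: "\<And>u. u \<in> gwords ?X \<Longrightarrow> \<phi> u \<in> carrier (local_group (panels W s) b)"
    "\<And>u v. u \<in> gwords ?X \<Longrightarrow> v \<in> gwords ?X \<Longrightarrow> \<phi> (u @ v) = gcomp (panels W s) (\<phi> u) (\<phi> v)"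
    "\<phi> [] = gid (panels W s) b"
    "\<And>g. g \<in> ?X \<Longrightarrow> \<phi> [(g, True)] = g"
    "\<And>u v. u \<in> gwords ?X \<Longrightarrow> v \<in> gwords ?X \<Longrightarrow>
      \<phi> u = \<phi> v \<longleftrightarrow> (u, v) \<in> pres_cong ?X (RB s b)"
    using base_eval[OF assms(2,3)] by blast
  have b: "b \<in> chambers W" using base_in assms by blast
  have loops: "h \<in> garcs (panels W s)" "gsrc (panels W s) h = b" "gtrg (panels W s) h = b"
    if "h \<in> carrier (local_group (panels W s) b)" for h
    using that by (simp_all add: local_group_def)
  have not_id: "g \<notin> gids (panels W s)" if "g \<in> ?X" for g
    using that loops[of g] by (auto simp: gids_def P.src_id)
  have letter: "letter_path x ((s, g), p) = conj_path x b (seg s (\<phi> [(g, p)]))" if g: "g \<in> ?X" for g p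
  proof (cases p)
    case True
    then show ?thesis
      using \<phi>(4)[OF g] not_id[OF g] loops[of g] g by (simp add: seg_def esrc_def)
  next
    case False
    \<comment> \<open>Free cancellation is part of the congruence, so \<open>\<phi>\<close> sends
      the inverse letter to the inverse arrow.\<close>
    have "\<phi> ([(g, True)] @ [(g, False)]) = \<phi> []"
      using \<phi>(5)[of "[(g, True), (g, False)]" "[]"] pres_cong.cancel[OF g, of True] g by simp
    then have "gcomp (panels W s) g (\<phi> [(g, False)]) = gid (panels W s) b"
      using \<phi>(2)[of "[(g, True)]" "[(g, False)]"] \<phi>(3) \<phi>(4)[OF g] g by simp
    then have "ginv (panels W s) g = \<phi> [(g, False)]"
      using g loops[of g] loops[OF \<phi>(1), of "[(g, False)]"] by (intro P.ginv_eqI) auto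
    then show ?thesis
      using False P.inv_in_gids_iff[of g] not_id[OF g] loops[of g] g
      by (simp add: seg_def etrg_def einv_def)
  qed
  have eval: "hcl x (word_path x (tag_word s u)) = hcl x (conj_path x b (seg s (\<phi> u)))"
    if "u \<in> gwords ?X" for u
    using that
  proof (induction u)
    case Nil
    have "\<phi> [] \<in> gids (panels W s)"
      using b panel_verts[OF assms(2)] \<phi>(3) by (simp add: gids_def)
    then show ?case
      using hclass_conj_path_Nil[OF assms(1) b] by (simp add: tag_word_def seg_def)
  next
    case (Cons a u)
    obtain g p where a: "a = (g, p)" by fastforce
    have g: "g \<in> ?X" "u \<in> gwords ?X" "[(g, p)] \<in> gwords ?X" using Cons.prems a by auto
    let ?h = "\<phi> [(g, p)]" and ?k = "\<phi> u"
    have h: "?h \<in> garcs (panels W s)" "gsrc (panels W s) ?h = b" "gtrg (panels W s) ?h = b"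
      and k: "?k \<in> garcs (panels W s)" "gsrc (panels W s) ?k = b" "gtrg (panels W s) ?k = b"
      using loops[OF \<phi>(1)[OF g(3)]] loops[OF \<phi>(1)[OF g(2)]] by auto
    have hk: "gcomp (panels W s) ?h ?k \<in> garcs (panels W s)"
      "gsrc (panels W s) (gcomp (panels W s) ?h ?k) = b"
      using h k by (simp_all add: P.comp_arc P.src_comp)
    note ph = seg_path[OF assms(2) h(1)] and pk = seg_path[OF assms(2) k(1)]
    have "hcl x (word_path x (tag_word s (a # u))) =
        hcl x (conj_path x b (seg s ?h) @ word_path x (tag_word s u))"
      using letter[OF g(1)] a by (simp add: tag_word_def)
    also have "\<dots> = hcl x (conj_path x b (seg s ?h) @ conj_path x b (seg s ?k))"
      using Cons.IH[OF g(2)] path_conj_path[OF assms(1)] ph pk h k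
        path_word_path[OF assms(1) tag_word_gwords[OF assms(2,3) g(2)]]
      by (intro hclass_loop_append_cong) auto
    also have "\<dots> = hcl x (conj_path x b (seg s ?h @ seg s ?k))"
      using ph pk h k assms(1) by (intro hclass_conj_path_append) auto
    also have "\<dots> = hcl x (conj_path x b (seg s (gcomp (panels W s) ?h ?k)))"
      using ph pk h k assms(1) hk seg_path[OF assms(2) hk(1)] hclass_seg_comp[OF assms(2) h(1) k(1)]
      by (intro hclass_conj_path_cong) auto
    also have "gcomp (panels W s) ?h ?k = \<phi> (a # u)"
      using \<phi>(2)[OF g(3,2)] a by simp
    finally show ?case .
  qed
  have "RB s b \<subseteq> gwords ?X \<times> gwords ?X"
    using base_rels assms
    by (simp add: is_base_relations_def Let_def local_group_def defining_relations_def)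
  then have lr: "l \<in> gwords ?X" "r \<in> gwords ?X"
    using assms(4) by auto
  then have "\<phi> l = \<phi> r"
    using \<phi>(5)[OF lr] assms(4) pres_cong.relation by blast
  then show ?thesis
    using eval[OF lr(1)] eval[OF lr(2)] by simp
qed

lemma word_path_relation:
  assumes "x \<in> chambers W" "(l, r) \<in> rels"
  shows "hcl x (word_path x l) = hcl x (word_path x r)"
proof -
  consider (suite) \<delta> where "\<delta> \<in> defining_suites S M W" "l = wd (snd \<delta>)" "r = []"
    | (base) s b l' r' where "s \<in> S" "b \<in> base D s" "(l', r') \<in> RB s b" "l = tag_word s l'" "r = tag_word s r'"
    | (inverse) i where "i \<in> gens_pos S W D" "l = pos_word [i, einv W i]" "r = []"
    | (tree) t where "t \<in> T" "l = pos_word [t]" "r = []"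
    using assms(2)
    unfolding pi1_relations_def suite_relations_def gal_expr_def wd_def[symmetric]
      base_relations_def inverse_relations_def tree_relations_def by blast
  then show ?thesis
  proof cases
    case suite
    obtain y p where \<delta>: "\<delta> = (y, p)" by fastforce
    have p: "path y p" using defining_suite_closed(1)[OF suite(1)] \<delta> by simp
    have "hcl x (word_path x (wd p)) = hcl x (conj_path x y p)"
      using word_path_wd assms(1) p by blast
    \<comment> \<open>A suite is null-homotopic at its own chamber \<open>y\<close>; conjugation
      transfers this to \<open>x\<close>.\<close>
    also have "\<dots> = hcl x (conj_path x y [])"
      using assms(1) p is_path_start[OF p] hclass_suite[of y p] suite(1) \<delta>
      by (intro hclass_conj_path_cong) auto
    finally show ?thesis
      using hclass_conj_path_Nil[OF assms(1) is_path_start[OF p]] suite \<delta> by simp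
  next
    case base
    then show ?thesis using word_path_base_relation assms(1) by simp
  next
    case inverse
    then have i: "i \<in> edges S W" using gens_pos_edge by blast
    \<comment> \<open>The positive letter \<open>einv W i\<close> and the formal inverse of
      \<open>i\<close> trace the same loop, so the relation \<open>ij = 1\<close> reduces to a free
      cancellation.\<close>
    then have "hcl x (conj_path x (esrc W i) [i] @ conj_path x (etrg W i) [einv W i]) = hcl x []"
      using hclass_letter_cancel[OF assms(1) i, of True] by simp
    then show ?thesis
      using inverse i by (simp add: esrc_einv)
  next
    case tree
    then have t: "t \<in> edges S W" using tree_edge by blast
    \<comment> \<open>The edge lies in the tree as well as both legs, so the whole loop
      contracts.\<close>
    have "set (conj_path x (esrc W t) [t]) \<subseteq> T"
      using tree(1) tree_path_subset[OF assms(1)] esrc_in[OF t] etrg_in[OF t] rpath_tree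
      by (simp add: conj_path_def)
    then show ?thesis
      using tree_closed_path path_conj_path[OF assms(1) edge_path[OF t]] tree by simp
  qed
qed

lemma word_path_cong:
  assumes "x \<in> chambers W" "(v, w) \<in> pres_cong gens rels"
  shows "hcl x (word_path x v) = hcl x (word_path x w)"
  using assms(2)
proof (induction rule: pres_cong.induct)
  case (mult v w v' w')
  then show ?case
    using path_word_path[OF assms(1) pres_cong_in_gwords(1)[OF mult.hyps(1)]]
      path_word_path[OF assms(1) pres_cong_in_gwords(2)[OF mult.hyps(1)]]
      path_word_path[OF assms(1) pres_cong_in_gwords(1)[OF mult.hyps(2)]]
      path_word_path[OF assms(1) pres_cong_in_gwords(2)[OF mult.hyps(2)]]
    by (simp add: hclass_loop_append_cong[of x "word_path x v" "word_path x w"])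
next
  case (cancel i b)
  then show ?case
    using hclass_letter_cancel[OF assms(1) generating_set_edge] by simp
next
  case (relation l r)
  then show ?case
    using word_path_relation assms(1) by blast
qed simp_all

lemma cls_wd_conj_path:
  assumes "x \<in> chambers W" "path y p"
  shows "cls (wd (conj_path x y p)) = cls (wd p)"
  unfolding conj_path_def
  using assms is_path_start[OF assms(2)] is_path_end[OF assms(2)] is_path_edges[OF assms(2)]
  by (intro cls_wd_tree_context rpath_tree tree_path_subset)

text \<open>Every word represents the same element as the loop that it traces, because the legs in
  the tree have trivial words. This yields surjectivity.\<close>

lemma cls_wd_word_path:
  assumes "x \<in> chambers W" "w \<in> gwords gens"
  shows "cls (wd (word_path x w)) = cls w"
  using assms(2)
proof (induction w)
  case (Cons a w)
  obtain i b where a: "a = (i, b)" by fastforce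
  then have i: "i \<in> gens" "i \<in> edges S W" "w \<in> gwords gens"
    using Cons.prems generating_set_edge by auto
  have gi: "wd [einv W i] \<in> gwords gens"
    using einv_edge[OF i(2)] by (intro wd_gwords) simp
  have "cls (wd (letter_path x (i, b))) = cls [(i, b)]"
  proof (cases b)
    case True
    then show ?thesis
      using cls_wd_conj_path[OF assms(1) edge_path[OF i(2)]] edge_expr_generator[OF i(1)] by simp
  next
    case False
    \<comment> \<open>The word of \<open>einv W i\<close> has positive letters only and must be
      compared with the formal inverse of \<open>i\<close>. A cancelling pair is inserted in front,
      and the backtrack then removes the rest.\<close>
    have "cls (wd [einv W i]) = cls ([] @ wd [einv W i])"
      by simp
    also have "\<dots> = cls ([(i, False), (i, True)] @ wd [einv W i])"
      using i(1) gi pres_class_cancel[of i gens rels False] by (intro pres_class_append_cong) auto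
    also have "\<dots> = cls ([(i, False)] @ wd [i, einv W i])"
      using edge_expr_generator[OF i(1)] by simp
    also have "\<dots> = cls ([(i, False)] @ [])"
      using i gi cls_wd_backtrack[OF i(2)] wd_gwords[of "[i, einv W i]"] einv_edge[OF i(2)]
      by (intro pres_class_append_cong) auto
    finally have "cls (wd [einv W i]) = cls [(i, False)]" by simp
    then show ?thesis
      using cls_wd_conj_path[OF assms(1) edge_path[OF einv_edge[OF i(2)]]] False
      by (simp add: esrc_einv[OF i(2)])
  qed
  then have "cls (wd (letter_path x a) @ wd (word_path x w)) = cls ([a] @ w)"
    using Cons.IH[OF i(3)] i a path_wd_gwords[OF path_letter_path(1)[OF assms(1) i(2)]]
      path_wd_gwords[OF path_word_path(1)[OF assms(1) i(3)]]
    by (intro pres_class_append_cong) auto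
  then show ?case by simp
qed simp

section \<open>The isomorphism and its behaviour along the tree\<close>

lemma pi1_of_gallery_wd: "pi1_of_gallery S M W D RB T (x, p) = cls (wd p)"
  by (simp add: pi1_of_gallery_def gal_expr_def wd_def)

text \<open>It is defined on all classes, not only on loops, so that one map serves every chamber;
  \<open>homotopy_cls_eq\<close> makes the choice of representative immaterial.\<close>

definition pi1_of_class :: "('s, 'c, 'e) gallery set \<Rightarrow> ('s \<times> 'e) gword set" where
  "pi1_of_class A = cls (wd (snd (SOME b. b \<in> A)))"

lemma pi1_of_class_hclass:
  assumes "path x p"
  shows "pi1_of_class (hcl x p) = cls (wd p)"
proof -
  have "((x, p), (x, p)) \<in> homotopy S M W"
    using assms by (simp add: homotopy_def)
  then have "(x, p) \<in> hcl x p"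
    by (simp add: hclass_def)
  then have "(SOME b. b \<in> hcl x p) \<in> hcl x p"
    by (rule someI)
  then have "((x, p), SOME b. b \<in> hcl x p) \<in> homotopy S M W"
    by (simp add: hclass_def)
  from homotopy_cls_eq[OF this] show ?thesis
    by (simp add: pi1_of_class_def)
qed

text \<open>If two loops have congruent words, the loops traced by these words are homotopic, and
  they are the given loops conjugated by \<open>tree_path x x\<close>, which changes nothing.
  Conversely a word is hit by the loop that it traces.\<close>

lemma pi1_of_class_iso:
  assumes "x \<in> chambers W"
  shows "pi1_of_class \<in> iso (local_group FG x) (pi1 S M W D RB T)"
proof (rule isoI)
  show "pi1_of_class \<in> hom (local_group FG x) (pi1 S M W D RB T)"
  proof (rule homI)
    fix A assume "A \<in> carrier (local_group FG x)"
    then show "pi1_of_class A \<in> carrier (pi1 S M W D RB T)"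
      using path_wd_gwords
      by (auto simp: carrier_local_group_FG pi1_def carrier_presented_group pi1_of_class_hclass)
  next
    fix A B assume "A \<in> carrier (local_group FG x)" "B \<in> carrier (local_group FG x)"
    then obtain p q where p: "A = hcl x p" "path x p" "gal_term W (x, p) = x"
      and q: "B = hcl x q" "path x q"
      by (auto simp: carrier_local_group_FG)
    have "A \<otimes>\<^bsub>local_group FG x\<^esub> B = hcl x (p @ q)"
      using p q FG_comp'[of x p x q] by (simp add: local_group_def)
    then show "pi1_of_class (A \<otimes>\<^bsub>local_group FG x\<^esub> B) = pi1_of_class A \<otimes>\<^bsub>pi1 S M W D RB T\<^esub> pi1_of_class B"
      using p q path_wd_gwords[OF p(2)] path_wd_gwords[OF q(2)]
      by (simp add: pi1_of_class_hclass pi1_def mult_presented_group)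
  qed
  show "bij_betw pi1_of_class (carrier (local_group FG x)) (carrier (pi1 S M W D RB T))"
    unfolding bij_betw_def
  proof
    show "inj_on pi1_of_class (carrier (local_group FG x))"
    proof (rule inj_onI)
      fix A B assume "A \<in> carrier (local_group FG x)" "B \<in> carrier (local_group FG x)"
        and eq: "pi1_of_class A = pi1_of_class B"
      then obtain p q where p: "A = hcl x p" "path x p" "gal_term W (x, p) = x"
        and q: "B = hcl x q" "path x q" "gal_term W (x, q) = x"
        by (auto simp: carrier_local_group_FG)
      have "(wd p, wd q) \<in> pres_cong gens rels"
        using eq p q path_wd_gwords[OF p(2)] path_wd_gwords[OF q(2)]
        by (simp add: pi1_of_class_hclass pres_class_eq_iff)
      from word_path_cong[OF assms this]
      have "hcl x (conj_path x x p) = hcl x (conj_path x x q)"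
        using word_path_wd[OF assms p(2)] word_path_wd[OF assms q(2)] by simp
      then show "A = B"
        using p q by (simp add: hclass_conj_path_loop)
    qed
    have "B \<in> pi1_of_class ` carrier (local_group FG x)" if B: "B \<in> carrier (pi1 S M W D RB T)" for B
    proof -
      obtain w where w: "w \<in> gwords gens" "B = cls w"
        using B by (auto simp: pi1_def carrier_presented_group)
      note wp = path_word_path[OF assms w(1)]
      have "B = pi1_of_class (hcl x (word_path x w))"
        using w pi1_of_class_hclass[OF wp(1)] cls_wd_word_path[OF assms w(1)] by simp
      moreover have "hcl x (word_path x w) \<in> carrier (local_group FG x)"
        using wp unfolding carrier_local_group_FG by blast
      ultimately show ?thesis by blast
    qed
    moreover have "pi1_of_class ` carrier (local_group FG x) \<subseteq> carrier (pi1 S M W D RB T)"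
      using path_wd_gwords
      by (auto simp: carrier_local_group_FG pi1_def carrier_presented_group pi1_of_class_hclass)
    ultimately show "pi1_of_class ` carrier (local_group FG x) = carrier (pi1 S M W D RB T)"
      by blast
  qed
qed

text \<open>Both legs of the conjugate have trivial words. Hence transport along the tree identifies
  the isomorphisms at different chambers.\<close>

lemma pi1_of_class_tree_conjugate:
  assumes "path x p" "set p \<subseteq> T" "g \<in> carrier (local_group FG x)"
  shows "pi1_of_class (gcomp FG (gcomp FG (ginv FG (hcl x p)) g) (hcl x p)) = pi1_of_class g"
proof -
  obtain q where q: "g = hcl x q" "path x q" "gal_term W (x, q) = x"
    using assms(3) by (auto simp: carrier_local_group_FG)
  note r = path_rpath[OF assms(1)]
  have "gcomp FG (gcomp FG (ginv FG (hcl x p)) g) (hcl x p) = hcl (gal_term W (x, p)) (rpath p @ q @ p)"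
    using assms(1) q r by (simp add: FG_inv FG_comp')
  then show ?thesis
    using cls_wd_tree_context[OF rpath_tree[OF assms(2)] assms(2) is_path_edges[OF q(2)]] assms q r
    by (simp add: pi1_of_class_hclass)
qed

end

theorem theorem6p1:
  fixes S :: "'s set" and M :: "'s \<Rightarrow> 's \<Rightarrow> enat" and W :: "('s, 'c, 'e) weyl_data"
    and D :: "('s, 'c, 'e) gen_data" and RB :: "'s \<Rightarrow> 'c \<Rightarrow> ('e gword \<times> 'e gword) set"
    and T :: "('s \<times> 'e) set"
  defines "F \<equiv> fundamental_groupoid S M W"
  assumes "coxeter_matrix S M"
    and "weyl_graph S M W"
    and "connected_weyl S W"
    and "is_gen_data S W D"
    and "is_base_relations S W D RB"
    and "weyl_spanning_tree S W D T"
  shows "\<exists>\<Phi>.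
    (\<forall>\<beta>\<in>galleries S W. \<Phi> (hclass S M W \<beta>) = pi1_of_gallery S M W D RB T \<beta>) \<and>
    (\<forall>x\<in>chambers W. \<Phi> \<in> iso (local_group F x) (pi1 S M W D RB T)) \<and>
    (\<forall>\<delta>\<in>tree_galleries S W T. \<forall>g\<in>carrier (local_group F (gal_init \<delta>)).
      \<Phi> (gcomp F (gcomp F (ginv F (hclass S M W \<delta>)) g) (hclass S M W \<delta>)) = \<Phi> g)"
proof -
  interpret pi1_setup S M W D T RB
    using assms by unfold_locales (simp_all add: weyl_graph_def pre_weyl_graph_def)
  show ?thesis
    unfolding F_def
    using pi1_of_class_hclass pi1_of_class_iso pi1_of_class_tree_conjugate
    by (intro exI[of _ pi1_of_class])
      (auto simp: galleries_def tree_galleries_def gal_init_def pi1_of_gallery_wd)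
qed

end
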